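(* There is an absolute constant $c'>0$ such that the following holds. Let $M,s\in\mathbb N$ with $M\ge2$, $\alpha>1/2$, $\boldsymbol\gamma=(\gamma_1,\gamma_2,\ldots)\in[0,1]^{\mathbb N}$ and $\tau\in(0,1)$. Then for any $1/2\le\lambda<\alpha$ and $0<\delta<1$, the root-mean-square error of the randomly shifted and then tent-transformed randomized rank-1 lattice rule $A^{\varphi}_{M,\tau,\Delta}$ in the weighted half-period cosine space satisfies $$e^{\mathrm{rms}}(H^{\cos}_{s,\alpha,\boldsymbol\gamma},A^{\varphi}_{M,\tau,\Delta})\le\left(\frac{c'}{\delta\tau M}\right)^{1/2}\left(\frac{2}{(1-\tau)M}\sum_{\emptyset\ne u\subseteq\{1,\ldots,s\}}\gamma_u^{1/\lambda}\bigl(2\zeta(\alpha/\lambda)\bigr)^{|u|}\right)^{\lambda(1-\delta/(2\alpha))}.$$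
   Context: Notation: $\mathbb N=\{1,2,\ldots\}$, $\mathbb N_0=\mathbb N\cup\{0\}$; $\zeta$ is the Riemann zeta function; $\gamma_u=\prod_{j\in u}\gamma_j$. $I(f)=\int_{[0,1]^s}f(\boldsymbol x)\,d\boldsymbol x$, and for a finite point (multi)set $P$ with $N$ elements, $I(f;P)=\frac1N\sum_{\boldsymbol x\in P}f(\boldsymbol x)$. For $\boldsymbol k\in\mathbb Z^{\ell}$ put $r_{\alpha,\boldsymbol\gamma}(\boldsymbol k)=\prod_{j:\,k_j\ne0}|k_j|^\alpha/\gamma_j$ (empty product $=1$; if $k_j\neq 0$ and $\gamma_j=0$ for some $j$, then $1/r_{\alpha,\boldsymbol\gamma}(\boldsymbol k)=0$). Weighted half-period cosine space. $H^{\cos}_{s,\alpha,\boldsymbol\gamma}$ is the space of functions $f:[0,1]^s\to\mathbb R$ with absolutely convergent cosine series $f(\boldsymbol x)=\sum_{\boldsymbol k\in\mathbb N_0^s}\bar f(\boldsymbol k)\prod_{j=1}^s(2-\delta_{0,k_j})^{1/2}\cos(\pi k_jx_j)$, where $\delta_{0,k}$ is the Kronecker delta and $\bar f(\boldsymbol k)=\int_{[0,1]^s}f(\boldsymbol x)\prod_{j=1}^s(2-\delta_{0,k_j})^{1/2}\cos(\pi k_jx_j)\,d\boldsymbol x$, and with finite norm $\|f\|^{\cos}_{s,\alpha,\boldsymbol\gamma}=\bigl(\sum_{\boldsymbol k\in\mathbb N_0^s}r_{\alpha,\boldsymbol\gamma}(\boldsymbol k)^2\bar f(\boldsymbol k)^2\bigr)^{1/2}$;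 if $\gamma_j=0$, it is required that $\bar f(\boldsymbol k)=0$ whenever $k_j\ne0$ (such terms contribute $0$ to the norm). Lattice rules. For $N\ge2$ and $\boldsymbol z\in\{1,\ldots,N-1\}^{\ell}$, $P_{N,\boldsymbol z}=\{\{n\boldsymbol z/N\}:n=0,\ldots,N-1\}$ (componentwise fractional parts); for $\Delta\in[0,1)^s$, $P_{N,\boldsymbol z}+\Delta=\{\{n\boldsymbol z/N+\Delta\}:n=0,\ldots,N-1\}$; $P_{N,\boldsymbol z}^\perp=\{\boldsymbol k\in\mathbb Z^{\ell}:\boldsymbol k\cdot\boldsymbol z\equiv0\pmod N\}$. The tent transformation is $\varphi(x)=1-|2x-1|$ on $[0,1]$, applied componentwise to vectors. Let $R_{\alpha,\boldsymbol\gamma}(\boldsymbol z)=\sum_{\boldsymbol k\in P_{N,\boldsymbol z}^\perp\setminus\{\boldsymbol 0\}}r_{\alpha,\boldsymbol\gamma}(\boldsymbol k)^{-2}$. Randomized component-by-component algorithm. Let $\mathbb P_M=\{N \text{ prime}:\lceil M/2\rceil<N\le M\}$. (1) Pick $N\in\mathbb P_M$ uniformly at random. (2) Set $z_1=1$. (3) For $\ell=2,\ldots,s$, given $\boldsymbol z_{\ell-1}=(z_1,\ldots,z_{\ell-1})$, let $Z_\ell\subset\{1,\ldots,N-1\}$ consist of the $\lceil\tau(N-1)\rceil$ elements $\zeta$ with the smallest values of $R_{\alpha,\boldsymbol\gamma}(\boldsymbol z_{\ell-1},\zeta)$ (ties broken in favour of the smaller integer), and pick $z_\ell\in Z_\ell$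 uniformly at random. For $N\in\mathbb P_M$, $\mathcal Z_{N,\tau}\subseteq\{1,\ldots,N-1\}^s$ denotes the set of all vectors $\boldsymbol z=(z_1,\ldots,z_s)$ that steps (2)–(3) can produce. The randomized algorithm is $A^{\varphi}_{M,\tau,\Delta}(f)=I(f\circ\varphi;P_{N,\boldsymbol z}+\Delta)$ with $N$ uniform in $\mathbb P_M$, $\boldsymbol z$ uniform in $\mathcal Z_{N,\tau}$ and $\Delta$ uniform in $[0,1)^s$, and $$e^{\mathrm{rms}}(H^{\cos}_{s,\alpha,\boldsymbol\gamma},A^{\varphi}_{M,\tau,\Delta})=\sup_{\|f\|^{\cos}_{s,\alpha,\boldsymbol\gamma}\le1}\left(\frac1{|\mathbb P_M|}\sum_{N\in\mathbb P_M}\frac1{|\mathcal Z_{N,\tau}|}\sum_{\boldsymbol z\in\mathcal Z_{N,\tau}}\int_{[0,1)^s}|I(f\circ\varphi;P_{N,\boldsymbol z}+\Delta)-I(f)|^2\,d\Delta\right)^{1/2}.$$ *)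

theory Defs
  imports "HOL-Analysis.Analysis" "HOL-Library.Multiset" "HOL-Computational_Algebra.Primes"
begin

text \<open>
  An \<open>l\<close>-dimensional vector is a function on \<open>{1..l}\<close> that is extensional outside that set,
  so \<open>s\<close> can be quantified over inside a formula.  Functions on the unit cube are total functions
  of such vectors; only their values on \<open>cube s\<close> are ever used.
\<close>

definition real_zeta :: "real \<Rightarrow> real" where
  "real_zeta x = (\<Sum>n. 1 / real (Suc n) powr x)"

definition cube :: "nat \<Rightarrow> (nat \<Rightarrow> real) set" where
  "cube s = ({1..s} \<rightarrow>\<^sub>E {0..1})"

definition half_open_cube :: "nat \<Rightarrow> (nat \<Rightarrow> real) set" where
  "half_open_cube s = ({1..s} \<rightarrow>\<^sub>E {0..<1})"

abbreviation lborel_dim :: "nat \<Rightarrow> (nat \<Rightarrow> real) measure" where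
  "lborel_dim s \<equiv> Pi\<^sub>M {1..s} (\<lambda>_. lborel)"

definition cube_integral :: "nat \<Rightarrow> ((nat \<Rightarrow> real) \<Rightarrow> real) \<Rightarrow> real" where
  "cube_integral s f = set_lebesgue_integral (lborel_dim s) (cube s) f"

definition qmc :: "((nat \<Rightarrow> real) \<Rightarrow> real) \<Rightarrow> (nat \<Rightarrow> real) multiset \<Rightarrow> real" where
  "qmc f P = (\<Sum>x\<in>#P. f x) / real (size P)"


text \<open>
  Since \<open>x / 0 = 0\<close>, the value is \<open>0\<close> as soon as \<open>k j \<noteq> 0\<close> and \<open>\<gamma> j = 0\<close> for some \<open>j\<close>.  This gives
  both conventions for zero weights: \<open>1 / r_weight \<alpha> \<gamma> l k = 0\<close> in the dual-lattice sum, and a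
  contribution \<open>0\<close> to the norm.
\<close>

definition r_weight :: "real \<Rightarrow> (nat \<Rightarrow> real) \<Rightarrow> nat \<Rightarrow> (nat \<Rightarrow> int) \<Rightarrow> real" where
  "r_weight \<alpha> \<gamma> l k = (\<Prod>j | j \<in> {1..l} \<and> k j \<noteq> 0. \<bar>real_of_int (k j)\<bar> powr \<alpha> / \<gamma> j)"


definition cos_basis :: "nat \<Rightarrow> (nat \<Rightarrow> nat) \<Rightarrow> (nat \<Rightarrow> real) \<Rightarrow> real" where
  "cos_basis s k x =
     (\<Prod>j\<in>{1..s}. sqrt (2 - (if k j = 0 then 1 else 0)) * cos (pi * real (k j) * x j))"

definition cos_coefficient :: "nat \<Rightarrow> ((nat \<Rightarrow> real) \<Rightarrow> real) \<Rightarrow> (nat \<Rightarrow> nat) \<Rightarrow> real" where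
  "cos_coefficient s f k = cube_integral s (\<lambda>x. f x * cos_basis s k x)"

definition cos_freqs :: "nat \<Rightarrow> (nat \<Rightarrow> nat) set" where
  "cos_freqs s = ({1..s} \<rightarrow>\<^sub>E UNIV)"

definition cos_norm_term ::
  "nat \<Rightarrow> real \<Rightarrow> (nat \<Rightarrow> real) \<Rightarrow> ((nat \<Rightarrow> real) \<Rightarrow> real) \<Rightarrow> (nat \<Rightarrow> nat) \<Rightarrow> real" where
  "cos_norm_term s \<alpha> \<gamma> f k =
     (r_weight \<alpha> \<gamma> s (\<lambda>j. int (k j)))\<^sup>2 * (cos_coefficient s f k)\<^sup>2"

text \<open>
  Integrability of \<open>f\<close> need not be required: the first two conditions make \<open>f\<close> continuous on the
  cube.
\<close>

definition cos_space :: "nat \<Rightarrow> real \<Rightarrow> (nat \<Rightarrow> real) \<Rightarrow> ((nat \<Rightarrow> real) \<Rightarrow> real) set" where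
  "cos_space s \<alpha> \<gamma> = {f.
     (\<forall>x\<in>cube s. (\<lambda>k. \<bar>cos_coefficient s f k * cos_basis s k x\<bar>) summable_on cos_freqs s) \<and>
     (\<forall>x\<in>cube s. ((\<lambda>k. cos_coefficient s f k * cos_basis s k x) has_sum f x) (cos_freqs s)) \<and>
     (\<forall>k\<in>cos_freqs s. \<forall>j\<in>{1..s}. \<gamma> j = 0 \<and> k j \<noteq> 0 \<longrightarrow> cos_coefficient s f k = 0) \<and>
     cos_norm_term s \<alpha> \<gamma> f summable_on cos_freqs s}"

definition cos_norm :: "nat \<Rightarrow> real \<Rightarrow> (nat \<Rightarrow> real) \<Rightarrow> ((nat \<Rightarrow> real) \<Rightarrow> real) \<Rightarrow> real" where
  "cos_norm s \<alpha> \<gamma> f = sqrt (\<Sum>\<^sub>\<infinity>k\<in>cos_freqs s. cos_norm_term s \<alpha> \<gamma> f k)"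


definition shifted_lattice ::
  "nat \<Rightarrow> nat \<Rightarrow> (nat \<Rightarrow> nat) \<Rightarrow> (nat \<Rightarrow> real) \<Rightarrow> (nat \<Rightarrow> real) multiset" where
  "shifted_lattice s N z \<Delta> =
     image_mset (\<lambda>n. \<lambda>j\<in>{1..s}. frac (real n * real (z j) / real N + \<Delta> j)) (mset_set {0..<N})"

definition dual_lattice :: "nat \<Rightarrow> nat \<Rightarrow> (nat \<Rightarrow> nat) \<Rightarrow> (nat \<Rightarrow> int) set" where
  "dual_lattice l N z = {k \<in> {1..l} \<rightarrow>\<^sub>E UNIV. int N dvd (\<Sum>j\<in>{1..l}. k j * int (z j))}"

definition R_crit :: "real \<Rightarrow> (nat \<Rightarrow> real) \<Rightarrow> nat \<Rightarrow> nat \<Rightarrow> (nat \<Rightarrow> nat) \<Rightarrow> real" where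
  "R_crit \<alpha> \<gamma> l N z =
     (\<Sum>\<^sub>\<infinity>k\<in>dual_lattice l N z - {\<lambda>j\<in>{1..l}. 0}. 1 / (r_weight \<alpha> \<gamma> l k)\<^sup>2)"

definition tent :: "real \<Rightarrow> real" where
  "tent x = 1 - \<bar>2 * x - 1\<bar>"

definition tent_vec :: "nat \<Rightarrow> (nat \<Rightarrow> real) \<Rightarrow> (nat \<Rightarrow> real)" where
  "tent_vec s x = (\<lambda>j\<in>{1..s}. tent (x j))"


definition prime_pool :: "nat \<Rightarrow> nat set" where
  "prime_pool M = {N. prime N \<and> \<lceil>real M / 2\<rceil> < int N \<and> N \<le> M}"

text \<open>
  \<open>sort_key\<close> is stable and \<open>[1..<N]\<close> is increasing, so ties are broken in favour of the smaller
  integer.  Only the components of \<open>z\<close> with index below \<open>l\<close> matter.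
\<close>

definition cbc_choices ::
  "real \<Rightarrow> (nat \<Rightarrow> real) \<Rightarrow> real \<Rightarrow> nat \<Rightarrow> nat \<Rightarrow> (nat \<Rightarrow> nat) \<Rightarrow> nat set" where
  "cbc_choices \<alpha> \<gamma> \<tau> N l z =
     set (take (nat \<lceil>\<tau> * (real N - 1)\<rceil>)
            (sort_key (\<lambda>\<zeta>. R_crit \<alpha> \<gamma> l N (z(l := \<zeta>))) [1..<N]))"

definition cbc_vectors ::
  "nat \<Rightarrow> real \<Rightarrow> (nat \<Rightarrow> real) \<Rightarrow> real \<Rightarrow> nat \<Rightarrow> (nat \<Rightarrow> nat) set" where
  "cbc_vectors s \<alpha> \<gamma> \<tau> N = {z \<in> {1..s} \<rightarrow>\<^sub>E {1..N - 1}.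
     z 1 = 1 \<and> (\<forall>l\<in>{2..s}. z l \<in> cbc_choices \<alpha> \<gamma> \<tau> N l z)}"

definition tent_mean_square_error ::
  "nat \<Rightarrow> real \<Rightarrow> (nat \<Rightarrow> real) \<Rightarrow> nat \<Rightarrow> real \<Rightarrow> ((nat \<Rightarrow> real) \<Rightarrow> real) \<Rightarrow> real" where
  "tent_mean_square_error s \<alpha> \<gamma> M \<tau> f =
     1 / real (card (prime_pool M)) * (\<Sum>N\<in>prime_pool M.
       1 / real (card (cbc_vectors s \<alpha> \<gamma> \<tau> N)) * (\<Sum>z\<in>cbc_vectors s \<alpha> \<gamma> \<tau> N.
         set_lebesgue_integral (lborel_dim s) (half_open_cube s)
           (\<lambda>\<Delta>. \<bar>qmc (f \<circ> tent_vec s) (shifted_lattice s N z \<Delta>) - cube_integral s f\<bar>\<^sup>2)))"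

text \<open>
  The supremum is taken in the extended nonnegative reals, so that an upper bound on it also
  asserts finiteness.
\<close>

definition tent_rms_error ::
  "nat \<Rightarrow> real \<Rightarrow> (nat \<Rightarrow> real) \<Rightarrow> nat \<Rightarrow> real \<Rightarrow> ennreal" where
  "tent_rms_error s \<alpha> \<gamma> M \<tau> =
     (SUP f \<in> {f \<in> cos_space s \<alpha> \<gamma>. cos_norm s \<alpha> \<gamma> f \<le> 1}.
        ennreal (sqrt (tent_mean_square_error s \<alpha> \<gamma> M \<tau> f)))"

end

theory Submission
  imports Defs "HOL-Number_Theory.Prime_Powers" "HOL-Real_Asymp.Real_Asymp"
begin

text \<open>
  After the tent transformation \<open>f\<close> has a one-periodic cosine expansion, so the mean square error over
  the shift is diagonal: it is the sum of \<open>a\<^sub>k\<^sup>2\<close> times the fraction of sign patterns \<open>e\<close> for which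
  \<open>(e\<^sub>j k\<^sub>j)\<^sub>j\<close> lies in the dual lattice.  It therefore suffices to bound, for every \<open>h \<noteq> 0\<close>, the
  probability that \<open>h\<close> lies in the random dual lattice by a multiple of \<open>r(h)\<^sup>2\<close>.
  The component-by-component averaging argument bounds \<open>R(z)\<close>, hence \<open>1 / r(h)\<^sup>2\<close> for every \<open>h\<close> that
  occurs with positive probability.  For such \<open>h\<close> the probability is at most \<open>2 / (\<tau> M)\<close> plus the
  proportion of primes in the pool dividing \<open>h\<close>, which is \<open>O(log |h\<^sub>i| / M)\<close> by a Chebyshev bound
  for the number of primes in \<open>(M/2, M]\<close>; the logarithm is absorbed by \<open>r(h)\<close> to the power \<open>\<delta> / \<alpha>\<close>.
\<close>


section \<open>Primes between M/2 and M\<close>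

text \<open>The randomness of \<open>N\<close> matters because a prime dividing every
  \<open>h j\<close> puts \<open>h\<close> into the dual lattice of every \<open>z\<close>. Such
  primes exceed M/2, so there are O(log |h_i| / log M) of them, against a pool of at least c M / log
  M; the two factors log M cancel. The other obstacle is that the bound 2 / (\<tau> M) does not
  depend on \<open>h\<close>, whereas the target, a multiple of r(h)^2, is small when r(h) is small.
  The bound on R(z) removes it: frequencies with r(h) < Q^(-lam), Q being the bracket in the
  theorem, do not occur at all. For the others r(h) Q^lam \<ge> 1, and Q^(2 lam (1 -
  \<delta>/(2\<alpha>))) r(h)^2 is at least r(h)^(\<delta>/\<alpha>), which leaves room for the
  logarithm. In Q, the factor 2 / M comes from N - 1 \<ge> M / 2, the factor 1 / (1 - \<tau>) from
  the share of candidates no better than the selected one, and the exponent 1 / lam from Jensen's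
  inequality with exponent 1 / (2 lam) \<le> 1, applied to sums of 1 / r^2.\<close>

definition chebyshev_psi :: "nat \<Rightarrow> real" where
  "chebyshev_psi n = (\<Sum>d=1..n. mangoldt d)"

text \<open>Writing each \<open>ln m\<close> with m \<le> n as the sum of \<open>mangoldt\<close>
  over the divisors of \<open>m\<close> counts every \<open>d\<close> exactly \<open>n div d\<close>
  times. The range may end at any K \<ge> n, where the extra terms vanish, so that the three
  factorials of a binomial coefficient can be compared term by term.\<close>

lemma ln_fact_eq_sum_mangoldt:
  "n \<le> K \<Longrightarrow> ln (fact n) = (\<Sum>d=1..K. mangoldt d * real (n div d))"
proof (induction n)
  case (Suc n)
  have "ln (fact (Suc n) :: real) = ln (real (Suc n)) + ln (fact n)"
    by (simp add: ln_mult)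
  also have "ln (real (Suc n)) = (\<Sum>d | d dvd Suc n. mangoldt d)"
    by (simp add: mangoldt_sum)
  also have "\<dots> = (\<Sum>d=1..K. if d dvd Suc n then mangoldt d else 0)"
  proof (intro sum.mono_neutral_cong_left)
    show "{d. d dvd Suc n} \<subseteq> {1..K}"
    proof
      fix d assume "d \<in> {d. d dvd Suc n}"
      then have "d dvd Suc n" by simp
      then have "d \<le> Suc n" "d \<noteq> 0" by (auto dest: dvd_imp_le intro!: Nat.gr0I)
      then show "d \<in> {1..K}" using Suc.prems by auto
    qed
  qed auto
  also have "\<dots> + ln (fact n) =
    (\<Sum>d=1..K. (if d dvd Suc n then mangoldt d else 0) + mangoldt d * real (n div d))"
    using Suc by (simp add: sum.distrib)
  also have "\<dots> = (\<Sum>d=1..K. mangoldt d * real (Suc n div d))"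
    by (intro sum.cong refl) (auto simp: div_Suc dvd_eq_mod_eq_0 algebra_simps)
  finally show ?case .
qed auto

lemma ln_binomial_eq_sum_mangoldt:
  assumes "k \<le> m"
  shows "ln (real (m choose k)) =
    (\<Sum>d=1..m. mangoldt d * (real (m div d) - real (k div d) - real ((m - k) div d)))"
proof -
  have "fact k * fact (m - k) * real (m choose k) = fact m"
    using binomial_fact_lemma[OF assms] by (metis of_nat_fact of_nat_mult)
  then have "ln (fact m) = ln (fact k * fact (m - k) * real (m choose k))" by simp
  also have "\<dots> = ln (fact k) + ln (fact (m-k)) + ln (real (m choose k))"
    using assms by (simp add: ln_mult)
  finally show ?thesis
    using assms by (simp add: ln_fact_eq_sum_mangoldt[of _ m] algebra_simps sum_subtractf sum.distrib)
qed

lemma chebyshev_psi_diff: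
  assumes "k \<le> m"
  shows "chebyshev_psi m - chebyshev_psi k = (\<Sum>d\<in>{k<..m}. mangoldt d)"
proof -
  have "{1..m} = {1..k} \<union> {k<..m}" using assms by auto
  then have "chebyshev_psi m = (\<Sum>d\<in>{1..k} \<union> {k<..m}. mangoldt d)"
    unfolding chebyshev_psi_def by (rule arg_cong)
  also have "\<dots> = chebyshev_psi k + (\<Sum>d\<in>{k<..m}. mangoldt d)"
    unfolding chebyshev_psi_def by (rule sum.union_disjoint) auto
  finally show ?thesis by simp
qed

lemma div_add_le_div: "(a div d :: nat) + b div d \<le> (a + b) div d"
proof (cases "d = 0")
  case False
  then show ?thesis
    by (metis add_mult_distrib2 add_mono div_le_mono mult.commute nonzero_mult_div_cancel_right times_div_less_eq_dividend)
qed auto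

text \<open>For k < d \<le> m the multiplier of \<open>mangoldt d\<close> is at least 1:
  \<open>m div d\<close> is positive while \<open>k div d\<close> and \<open>(m - k) div d\<close>
  vanish, the latter because m - k \<le> k. All other multipliers are nonnegative since floors are
  superadditive.\<close>

lemma chebyshev_psi_diff_le_ln_binomial:
  assumes "k \<le> m" "m - k \<le> k"
  shows "chebyshev_psi m - chebyshev_psi k \<le> ln (real (m choose k))"
proof -
  have "chebyshev_psi m - chebyshev_psi k = (\<Sum>d\<in>{k<..m}. mangoldt d)"
    using assms by (intro chebyshev_psi_diff)
  also have "\<dots> \<le> (\<Sum>d\<in>{k<..m}. mangoldt d * (real (m div d) - real (k div d) - real ((m - k) div d)))"
  proof (intro sum_mono)
    fix d assume d: "d \<in> {k<..m}"
    have "m div d \<ge> 1" using d by (simp add: div_greater_zero_iff Suc_le_eq)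
    then have "1 \<le> real (m div d) - real (k div d) - real ((m - k) div d)" using d assms by simp
    from mult_left_mono[OF this mangoldt_nonneg[of d]]
    show "mangoldt d \<le> mangoldt d * (real (m div d) - real (k div d) - real ((m - k) div d))" by simp
  qed
  also have "\<dots> \<le> (\<Sum>d\<in>{1..m}. mangoldt d * (real (m div d) - real (k div d) - real ((m - k) div d)))"
  proof (intro sum_mono2)
    fix d
    have "k div d + (m - k) div d \<le> m div d" using div_add_le_div[of k d "m - k"] assms by simp
    then show "0 \<le> mangoldt d * (real (m div d) - real (k div d) - real ((m - k) div d))"
      by (intro mult_nonneg_nonneg mangoldt_nonneg) linarith
  qed auto
  finally show ?thesis using ln_binomial_eq_sum_mangoldt[OF assms(1)] by simp
qed

text \<open>Chebyshev's bound by halving: passing from \<open>m\<close> to \<open>2 * m\<close>, or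
  from \<open>m + 1\<close> to \<open>2 * m + 1\<close>, costs the logarithm of a binomial
  coefficient, at most \<open>m * ln 4\<close>. In the odd case the coefficient occurs twice in a
  row whose sum is 2 * 4^m.\<close>

lemma chebyshev_psi_le: "chebyshev_psi n \<le> real n * ln 4"
proof (induction n rule: less_induct)
  case (less n)
  \<comment> \<open>m \<ge> 1 gives m + 1 < 2 * m + 1, so the induction hypothesis applies in the
    odd case.\<close>
  consider "n \<le> 1" | m where "n = 2 * m" "m \<ge> 1" | m where "n = 2 * m + 1" "m \<ge> 1"
  proof (cases "even n")
    case True
    then obtain m where "n = 2 * m" by (rule evenE)
    then show ?thesis using that(1) that(2)[of m] by linarith
  next
    case False
    then obtain m where "n = 2 * m + 1" by (rule oddE)
    then show ?thesis using that(1) that(3)[of m] by linarith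
  qed
  then show ?case
  proof cases
    case 1
    then have "n = 0 \<or> n = 1" by auto
    then show ?thesis by (auto simp: chebyshev_psi_def)
  next
    case 2
    have "2 * m choose m \<le> 4 ^ m"
      using binomial_le_pow2[of "2*m" m] by (simp add: power_mult)
    then have "real (2 * m choose m) \<le> 4 ^ m"
      by (metis of_nat_le_iff of_nat_numeral of_nat_power)
    then have "ln (real (2 * m choose m)) \<le> ln (4 ^ m)"
      by (intro ln_mono) auto
    then show ?thesis
      using chebyshev_psi_diff_le_ln_binomial[of m "2*m"] less.IH[of m] 2
      by (simp add: ln_realpow)
  next
    case 3
    have "2 * (2 * m + 1 choose m) = (2 * m + 1 choose m) + (2 * m + 1 choose (m + 1))"
      using binomial_symmetric[of m "2*m+1"] by simp
    also have "\<dots> = (\<Sum>i\<in>{m,m+1}. 2 * m + 1 choose i)" by simp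
    also have "\<dots> \<le> (\<Sum>i\<le>2*m+1. 2 * m + 1 choose i)" by (intro sum_mono2) auto
    also have "\<dots> = 2 * 4 ^ m" by (simp only: choose_row_sum) (simp add: power_mult)
    finally have "2 * m + 1 choose m \<le> 4 ^ m" by simp
    then have "2 * m + 1 choose (m + 1) \<le> 4 ^ m"
      using binomial_symmetric[of m "2*m+1"] by simp
    then have "real (2 * m + 1 choose (m + 1)) \<le> 4 ^ m"
      by (metis of_nat_le_iff of_nat_numeral of_nat_power)
    moreover have "0 < 2 * m + 1 choose (m + 1)" by (rule zero_less_binomial) simp
    ultimately have "ln (real (2 * m + 1 choose (m + 1))) \<le> ln (4 ^ m)"
      by (intro ln_mono) (simp_all only: of_nat_0_less_iff)
    then show ?thesis
      using chebyshev_psi_diff_le_ln_binomial[of "m+1" "2*m+1"] less.IH[of "m+1"] 3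
      by (simp add: ln_realpow algebra_simps)
  qed
qed

text \<open>The multiplier \<open>\<lfloor>2 n / d\<rfloor> - 2 \<lfloor>n / d\<rfloor>\<close> of \<open>\<Lambda>(d)\<close> is at most one and vanishes for
  \<open>2 n / 3 < d \<le> n\<close>.\<close>

lemma ln_central_binomial_le:
  "ln (real (2 * n choose n)) \<le>
     chebyshev_psi (2 * n) - chebyshev_psi n + chebyshev_psi (2 * n div 3)"
proof -
  let ?c = "\<lambda>d. real (2 * n div d) - real (n div d) - real (n div d)"
  have *: "{1..2*n} = {1..2*n div 3} \<union> ({2*n div 3<..n} \<union> {n<..2*n})" by auto
  have c1: "?c d \<le> 1" if "d \<ge> 1" for d
  proof -
    have "2 * n < 2 * (n div d) * d + 2 * d"
      using div_mult_mod_eq[of n d] mod_less_divisor[of d n] that by (metis One_nat_def Suc_le_eq add_less_cancel_left distrib_left mult.assoc mult_2 nat_mult_less_cancel1 zero_less_numeral add.commute)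
    then have "2 * n < (2 * (n div d) + 2) * d" by (simp add: algebra_simps)
    then have "2 * n div d < 2 * (n div d) + 2" by (rule less_mult_imp_div_less)
    then show ?thesis by linarith
  qed
  have c0: "?c d = 0" if "d \<in> {2*n div 3<..n}" for d
  proof -
    have "n div d = 1" using that by (intro div_nat_eqI) auto
    moreover have "2 * n div d = 2" using that by (intro div_nat_eqI) auto
    ultimately show ?thesis by simp
  qed
  have "ln (real (2 * n choose n)) = (\<Sum>d=1..2*n. mangoldt d * ?c d)"
    using ln_binomial_eq_sum_mangoldt[of n "2*n"] by simp
  also have "\<dots> = (\<Sum>d=1..2*n div 3. mangoldt d * ?c d) + (\<Sum>d\<in>{2*n div 3<..n}. mangoldt d * ?c d)
     + (\<Sum>d\<in>{n<..2*n}. mangoldt d * ?c d)"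
    unfolding * by (subst sum.union_disjoint | force)+
  also have "(\<Sum>d\<in>{2*n div 3<..n}. mangoldt d * ?c d) = 0"
    using c0 by (intro sum.neutral) auto
  also have "(\<Sum>d=1..2*n div 3. mangoldt d * ?c d) \<le> chebyshev_psi (2 * n div 3)"
    unfolding chebyshev_psi_def using c1
    by (intro sum_mono mult_left_le mangoldt_nonneg) auto
  also have "(\<Sum>d\<in>{n<..2*n}. mangoldt d * ?c d) \<le> (\<Sum>d\<in>{n<..2*n}. mangoldt d)"
    by (intro sum_mono mult_left_le mangoldt_nonneg c1) auto
  also have "(\<Sum>d\<in>{n<..2*n}. mangoldt d) = chebyshev_psi (2 * n) - chebyshev_psi n"
    by (rule chebyshev_psi_diff[symmetric]) simp
  finally show ?thesis by simp
qed

text \<open>Two powers of the same prime cannot both lie in \<open>{n<..2 * n}\<close>, and the base of a proper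
  prime power is at most the square root.\<close>

lemma card_proper_primepow_le:
  "real (card {d \<in> {n<..2*n}. primepow d \<and> \<not> prime d}) \<le> sqrt (real (2 * n))"
proof -
  let ?S = "{d \<in> {n<..2*n}. primepow d \<and> \<not> prime d}"
  have *: "\<exists>p k. prime p \<and> k \<ge> 2 \<and> d = p ^ k \<and> aprimedivisor d = p" if "d \<in> ?S" for d
  proof -
    have "primepow d" using that by simp
    then obtain p k where pk: "prime p" "k > 0" "d = p ^ k" unfolding primepow_def by blast
    then have "k \<noteq> 1" using that by auto
    then show ?thesis using pk by (intro exI[of _ p] exI[of _ k]) (auto simp: aprimedivisor_prime_power)
  qed
  have inj: "inj_on aprimedivisor ?S"
  proof (rule inj_onI)
    fix d e assume d: "d \<in> ?S" and e: "e \<in> ?S" and eq: "aprimedivisor d = aprimedivisor e"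
    have key: "\<not> k < l" if "p ^ k > n" "p ^ l \<le> 2 * n" "prime p" for p k l :: nat
    proof
      assume "k < l"
      then have "p ^ Suc k \<le> p ^ l" using that prime_ge_2_nat[of p] by (intro power_increasing) auto
      moreover have "2 * p ^ k \<le> p ^ Suc k"
        unfolding power_Suc by (intro mult_right_mono prime_ge_2_nat that) simp
      ultimately show False using that by linarith
    qed
    obtain p k where p: "prime p" "d = p ^ k" "aprimedivisor d = p" using *[OF d] by blast
    obtain q l where q: "prime q" "e = q ^ l" "aprimedivisor e = q" using *[OF e] by blast
    have "p = q" using eq p q by simp
    then have "k = l" using key[of p k l] key[of p l k] p q d e by auto
    then show "d = e" using p q \<open>p = q\<close> by simp
  qed
  have "aprimedivisor ` ?S \<subseteq> {1..nat \<lfloor>sqrt (real (2 * n))\<rfloor>}"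
  proof
    fix x assume "x \<in> aprimedivisor ` ?S"
    then obtain d where d: "d \<in> ?S" "x = aprimedivisor d" by auto
    obtain p k where p: "prime p" "k \<ge> 2" "d = p ^ k" "aprimedivisor d = p" using *[OF d(1)] by blast
    have "p ^ 2 \<le> p ^ k" using p prime_ge_2_nat[of p] by (intro power_increasing) auto
    then have "p ^ 2 \<le> 2 * n" using p d by auto
    then have "real p \<le> sqrt (real (2 * n))" by (metis of_nat_le_iff of_nat_power real_le_rsqrt)
    then show "x \<in> {1..nat \<lfloor>sqrt (real (2 * n))\<rfloor>}" using p d prime_ge_1_nat[of p] by (auto simp: le_nat_floor)
  qed
  then have "card ?S \<le> nat \<lfloor>sqrt (real (2 * n))\<rfloor>"
    using card_inj_on_le[OF inj, of "{1..nat \<lfloor>sqrt (real (2 * n))\<rfloor>}"] by simp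
  then show ?thesis by (smt (verit) of_nat_floor of_nat_le_iff real_sqrt_ge_zero of_nat_0_le_iff)
qed

text \<open>The central binomial coefficient is at least 4^n / (2 n), and two thirds of
  \<open>n * ln 4\<close> are lost to \<open>chebyshev_psi (2 * n div 3)\<close>. The rest is
  carried by the prime powers in (n, 2n], each weighing at most
  \<open>ln (2 * real n)\<close>.\<close>

lemma card_primes_ge:
  assumes n: "n \<ge> 1"
  shows "real n / 3 * ln 4 - ln (2 * real n) \<le>
    (real (card {p \<in> {n<..2*n}. prime p}) + sqrt (real (2 * n))) * ln (2 * real n)"
proof -
  let ?P = "{p \<in> {n<..2*n}. prime p}" and ?S = "{d \<in> {n<..2*n}. primepow d \<and> \<not> prime d}"
  have "ln (4 ^ n / (2 * real n)) \<le> ln (real (2 * n choose n))"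
    using central_binomial_lower_bound[of n] n by (intro ln_mono) auto
  then have "real n * ln 4 - ln (2 * real n) \<le> ln (real (2 * n choose n))"
    using n by (simp add: ln_div ln_realpow)
  also have "\<dots> \<le> chebyshev_psi (2 * n) - chebyshev_psi n + chebyshev_psi (2 * n div 3)"
    by (rule ln_central_binomial_le)
  also have "chebyshev_psi (2 * n div 3) \<le> real (2 * n div 3) * ln 4" by (rule chebyshev_psi_le)
  also have "\<dots> \<le> (2 * real n / 3) * ln 4"
    by (intro mult_right_mono) (use of_nat_mono[OF times_div_less_eq_dividend[of 3 "2*n"], where ?'a=real] in auto)
  also have "chebyshev_psi (2 * n) - chebyshev_psi n = (\<Sum>d\<in>{n<..2*n}. mangoldt d)"
    by (rule chebyshev_psi_diff) simp
  also have "\<dots> = (\<Sum>d\<in>?P \<union> ?S. mangoldt d)"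
    by (intro sum.mono_neutral_right) (auto simp: mangoldt_def)
  also have "\<dots> \<le> (\<Sum>d\<in>?P \<union> ?S. ln (2 * real n))"
  proof (intro sum_mono)
    fix d assume "d \<in> ?P \<union> ?S"
    then have "0 < d" "d \<le> 2 * n" by auto
    then have "real d \<le> 2 * real n" by linarith
    then have "ln (real d) \<le> ln (2 * real n)" using \<open>0 < d\<close> by (intro ln_mono) auto
    then show "mangoldt d \<le> ln (2 * real n)" using mangoldt_le[of d] \<open>0 < d\<close> by simp
  qed
  also have "\<dots> = (real (card ?P) + real (card ?S)) * ln (2 * real n)"
    by (subst sum.union_disjoint) (auto simp: algebra_simps)
  also have "\<dots> \<le> (real (card ?P) + sqrt (real (2 * n))) * ln (2 * real n)"
    using card_proper_primepow_le[of n] n by (intro mult_right_mono) auto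
  finally show ?thesis by (simp add: algebra_simps)
qed

section \<open>Size of the pool, and how many of its primes divide an integer\<close>

lemma finite_prime_pool [simp]: "finite (prime_pool M)"
  by (rule finite_subset[of _ "{..M}"]) (auto simp: prime_pool_def)

lemma prime_pool_card_ge:
  "\<exists>c>0. \<forall>M\<ge>2. prime_pool M \<noteq> {} \<longrightarrow> c * real M \<le> real (card (prime_pool M)) * ln (real M)"
proof -
  \<comment> \<open>The left side grows like n / 3, so 1/100 could be any constant below
    1/6.\<close>
  have "eventually (\<lambda>n::nat. (real n / 3 - ln (2 * real n)) - (sqrt (2 * real n) + 1) * ln (2 * real n)
     \<ge> 1/100 * (2 * real n + 1)) at_top" by real_asymp
  then obtain n0 where n0': "\<And>n. n \<ge> n0 \<Longrightarrow>
     (real n / 3 - ln (2 * real n)) - (sqrt (2 * real n) + 1) * ln (2 * real n) \<ge> 1/100 * (2 * real n + 1)"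
    by (auto simp: eventually_at_top_linorder)
  have "1 \<le> ln (4 :: real)" using ln_ge_iff[of 4 1] exp_le by simp
  then have n0: "1/100 * (2 * real n + 1) \<le>
     (real n / 3 * ln 4 - ln (2 * real n)) - (sqrt (real (2 * n)) + 1) * ln (2 * real n)" if "n \<ge> n0" for n
    using n0'[OF that] mult_left_mono[of 1 "ln 4" "real n / 3"] by simp
  define M0 where "M0 = 2 * n0 + 2"
  \<comment> \<open>The second entry serves M \<le> M0, where a nonempty pool has at least one
    element and \<open>ln (real M)\<close> is at least ln 2.\<close>
  define c where "c = min (1/100) (ln 2 / real M0)"
  show ?thesis
  proof (intro exI[of _ c] conjI allI impI)
    show "c > 0" by (simp add: c_def M0_def)
    fix M :: nat assume M: "2 \<le> M" and ne: "prime_pool M \<noteq> {}"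
    show "c * real M \<le> real (card (prime_pool M)) * ln (real M)"
    proof (cases "M \<le> M0")
      case True
      have "c * real M \<le> ln 2 / real M0 * real M0" using True
        by (intro mult_mono) (auto simp: c_def)
      also have "\<dots> = ln 2" by (simp add: M0_def)
      also have "\<dots> \<le> 1 * ln (real M)" using M by simp
      also have "\<dots> \<le> real (card (prime_pool M)) * ln (real M)"
        using ne M by (intro mult_right_mono) (auto simp: Suc_le_eq card_gt_0_iff)
      finally show ?thesis .
    next
      case False
      define n where "n = M div 2"
      have n: "n \<ge> n0" "n \<ge> 1" using False by (auto simp: n_def M0_def)
      have M2: "2 * n \<le> M" "M \<le> 2 * n + 1" by (auto simp: n_def)
      \<comment> \<open>For odd \<open>M\<close> the ceiling of M / 2 is n + 1, so n + 1 may be a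
        prime outside the pool; this loses at most one element.\<close>
      have "{p \<in> {n<..2*n}. prime p} \<subseteq> insert (n+1) (prime_pool M)"
      proof
        fix p assume p: "p \<in> {p \<in> {n<..2*n}. prime p}"
        have "p \<in> prime_pool M" if "p \<noteq> n + 1"
        proof -
          have "real M / 2 \<le> real_of_int (int n + 1)" using M2 by simp
          then have "\<lceil>real M / 2\<rceil> \<le> int n + 1" by (simp add: ceiling_le_iff)
          then show ?thesis using p that M2 by (auto simp: prime_pool_def)
        qed
        then show "p \<in> insert (n+1) (prime_pool M)" by auto
      qed
      then have "card {p \<in> {n<..2*n}. prime p} \<le> card (insert (n+1) (prime_pool M))"
        by (intro card_mono) auto
      also have "\<dots> \<le> card (prime_pool M) + 1" by (simp add: card_insert_if)
      finally have cd: "real (card {p \<in> {n<..2*n}. prime p}) \<le> real (card (prime_pool M)) + 1" by linarith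
      have "c \<le> 1/100" unfolding c_def by (rule min.cobounded1)
      then have "c * real M \<le> 1/100 * (2 * real n + 1)" using M2
        by (intro mult_mono) auto
      also have "\<dots> \<le> (real n / 3 * ln 4 - ln (2 * real n)) - (sqrt (real (2 * n)) + 1) * ln (2 * real n)"
        by (rule n0[OF n(1)])
      also have "\<dots> \<le> (real (card {p \<in> {n<..2*n}. prime p}) - 1) * ln (2 * real n)"
        using card_primes_ge[OF n(2)] by (simp add: algebra_simps)
      also have "\<dots> \<le> real (card (prime_pool M)) * ln (2 * real n)"
        using cd n by (intro mult_right_mono) auto
      also have "\<dots> \<le> real (card (prime_pool M)) * ln (real M)"
      proof -
        have "2 * real n \<le> real M" using M2 by linarith
        then show ?thesis using n by (intro mult_left_mono ln_mono) auto
      qed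
      finally show ?thesis .
    qed
  qed
qed

lemma prime_pool_gt: "N \<in> prime_pool M \<Longrightarrow> real M / 2 \<le> real N - 1"
  unfolding prime_pool_def by (auto simp: ceiling_less_iff)

text \<open>The product of the primes counted divides \<open>k\<close>, and each satisfies N^2 \<ge>
  (M/2 + 1)^2 \<ge> M, so \<open>M\<close> to the power of their number is at most k^2. The factor
  \<open>ln (real M)\<close> stays on the left to cancel against the size of the pool.\<close>

lemma card_prime_divisors_pool_le:
  assumes M: "2 \<le> M" and k: "k > 0"
  shows "real (card {N \<in> prime_pool M. N dvd k}) * ln (real M) \<le> 2 * ln (real k)"
proof -
  let ?D = "{N \<in> prime_pool M. N dvd k}"
  have fin: "finite ?D" by (rule finite_subset[OF _ finite_prime_pool]) auto
  have sq: "real M \<le> real N ^ 2" if "N \<in> ?D" for N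
  proof -
    have "real N \<ge> real M / 2 + 1" using prime_pool_gt[of N M] that by auto
    then have "real N ^ 2 \<ge> (real M / 2 + 1) ^ 2" by (intro power_mono) auto
    moreover have "(real M / 2 + 1) ^ 2 \<ge> real M" by (simp add: power2_eq_square field_simps)
    ultimately show ?thesis by linarith
  qed
  have "mset_set ?D \<subseteq># mset_set (prime_factors k)"
    using k by (intro subset_imp_msubset_mset_set) (auto simp: prime_pool_def prime_factors_dvd)
  also have "\<dots> \<subseteq># prime_factorization k" by (rule mset_set_set_mset_msubset)
  finally have "prod_mset (mset_set ?D) dvd prod_mset (prime_factorization k)"
    by (rule prod_mset_subset_imp_dvd)
  then have "\<Prod>?D dvd k"
    using k by (simp add: prod_mset_prime_factorization_nat prod_unfold_prod_mset)
  then have le: "\<Prod>?D \<le> k" using k by (rule dvd_imp_le)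
  have "real M ^ card ?D \<le> (\<Prod>N\<in>?D. real N ^ 2)"
    using prod_mono[of ?D "\<lambda>_. real M" "\<lambda>N. real N ^ 2"] sq by simp
  also have "\<dots> = real (\<Prod>?D) ^ 2" by (simp add: prod_power_distrib)
  also have "\<dots> \<le> real k ^ 2" using le by (intro power_mono) (simp_all only: of_nat_le_iff of_nat_0_le_iff)
  finally have "ln (real M ^ card ?D) \<le> ln (real k ^ 2)" using M by (intro ln_mono) auto
  then show ?thesis using M k by (simp add: ln_realpow)
qed

section \<open>Component-by-component construction\<close>

text \<open>One coordinate's factor of a power of \<open>1 / r_weight\<close>. Exponent and weight
  stay free because two powers occur: the square, whose sum is \<open>R_crit\<close>, with exponent
  2 \<alpha>, and its root from Jensen's inequality, with exponent \<alpha> / lam.\<close>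

definition freq_weight :: "real \<Rightarrow> real \<Rightarrow> int \<Rightarrow> real" where
  "freq_weight x g k = (if k = 0 then 1 else g / \<bar>real_of_int k\<bar> powr x)"

lemma freq_weight_nonneg: "0 \<le> g \<Longrightarrow> 0 \<le> freq_weight x g k"
  by (simp add: freq_weight_def)

lemma r_weight_nonneg:
  assumes "\<And>j. j \<in> {1..l} \<Longrightarrow> 0 \<le> \<gamma> j"
  shows "0 \<le> r_weight \<alpha> \<gamma> l k"
  unfolding r_weight_def using assms by (intro prod_nonneg) auto

lemma inverse_r_weight_powr:
  assumes "\<And>j. j \<in> {1..l} \<Longrightarrow> 0 \<le> \<gamma> j"
  shows "(1 / r_weight \<alpha> \<gamma> l k) powr p = (\<Prod>j\<in>{1..l}. freq_weight (\<alpha> * p) (\<gamma> j powr p) (k j))"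
proof -
  have "1 / r_weight \<alpha> \<gamma> l k = (\<Prod>j | j \<in> {1..l} \<and> k j \<noteq> 0. \<gamma> j / \<bar>real_of_int (k j)\<bar> powr \<alpha>)"
    unfolding r_weight_def by (simp add: prod_inversef[symmetric] divide_inverse mult.commute)
  then have "(1 / r_weight \<alpha> \<gamma> l k) powr p = (\<Prod>j | j \<in> {1..l} \<and> k j \<noteq> 0. (\<gamma> j / \<bar>real_of_int (k j)\<bar> powr \<alpha>) powr p)"
    by (simp add: prod_powr_distrib)
  also have "\<dots> = (\<Prod>j | j \<in> {1..l} \<and> k j \<noteq> 0. freq_weight (\<alpha> * p) (\<gamma> j powr p) (k j))"
    using assms by (intro prod.cong) (auto simp: freq_weight_def powr_divide powr_powr)
  also have "\<dots> = (\<Prod>j\<in>{1..l}. freq_weight (\<alpha> * p) (\<gamma> j powr p) (k j))"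
    by (intro prod.mono_neutral_left) (auto simp: freq_weight_def)
  finally show ?thesis .
qed

lemma real_zeta_summable: "1 < x \<Longrightarrow> summable (\<lambda>n. 1 / real (Suc n) powr x)"
  using summable_Suc_iff[of "\<lambda>n. real n powr (- x)"] summable_real_powr_iff[of "- x"]
  by (simp add: powr_minus divide_inverse)

lemma real_zeta_nonneg: "1 < x \<Longrightarrow> 0 \<le> real_zeta x"
  unfolding real_zeta_def by (intro suminf_nonneg real_zeta_summable) auto

lemma sum_inverse_powr_int_le:
  assumes x: "1 < x" and F: "finite F" "0 \<notin> F"
  shows "(\<Sum>k\<in>F. 1 / \<bar>real_of_int k\<bar> powr x) \<le> 2 * real_zeta x"
proof -
  let ?f = "\<lambda>k. 1 / \<bar>real_of_int k\<bar> powr x"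
  have half: "(\<Sum>k\<in>G. ?f k) \<le> real_zeta x"
    if G: "finite G" "0 \<notin> G" and inj: "inj_on abs G" for G :: "int set"
  proof -
    let ?h = "\<lambda>k::int. nat \<bar>k\<bar> - 1"
    have inj': "inj_on ?h G"
    proof (rule inj_onI)
      fix a b assume ab: "a \<in> G" "b \<in> G" "?h a = ?h b"
      then have "a \<noteq> 0" "b \<noteq> 0" using G by auto
      then have "\<bar>a\<bar> = \<bar>b\<bar>" using ab(3) by linarith
      then show "a = b" using inj ab by (auto dest: inj_onD)
    qed
    have "(\<Sum>k\<in>G. ?f k) = (\<Sum>k\<in>G. 1 / real (Suc (?h k)) powr x)"
    proof (intro sum.cong refl)
      fix k assume "k \<in> G"
      then have "k \<noteq> 0" using G by auto
      then have "real (Suc (?h k)) = \<bar>real_of_int k\<bar>" by linarith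
      then show "?f k = 1 / real (Suc (?h k)) powr x" by presburger
    qed
    also have "\<dots> = (\<Sum>n\<in>?h ` G. 1 / real (Suc n) powr x)"
      using inj' by (simp add: sum.reindex)
    also have "\<dots> \<le> real_zeta x"
      unfolding real_zeta_def using G by (intro sum_le_suminf real_zeta_summable x) auto
    finally show ?thesis .
  qed
  have "(\<Sum>k\<in>F. ?f k) = (\<Sum>k\<in>{k\<in>F. 0 < k} \<union> {k\<in>F. k < 0}. ?f k)"
    using F by (intro sum.cong) (auto simp: neq_iff intro: linorder_cases)
  also have "\<dots> = (\<Sum>k\<in>{k\<in>F. 0 < k}. ?f k) + (\<Sum>k\<in>{k\<in>F. k < 0}. ?f k)"
    using F by (intro sum.union_disjoint) auto
  also have "\<dots> \<le> real_zeta x + real_zeta x"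
    using F by (intro add_mono half) (auto simp: inj_on_def)
  finally show ?thesis by simp
qed

lemma sum_freq_weight_le:
  assumes "1 < x" "0 \<le> g" "finite F"
  shows "(\<Sum>k\<in>F. freq_weight x g k) \<le> 1 + g * (2 * real_zeta x)"
proof -
  have "(\<Sum>k\<in>F. freq_weight x g k) \<le> (\<Sum>k\<in>insert 0 F. freq_weight x g k)"
    using assms by (intro sum_mono2) (auto simp: freq_weight_nonneg)
  also have "\<dots> = 1 + (\<Sum>k\<in>F - {0}. freq_weight x g k)"
    using assms by (simp add: sum.insert_remove freq_weight_def)
  also have "(\<Sum>k\<in>F - {0}. freq_weight x g k) = g * (\<Sum>k\<in>F - {0}. 1 / \<bar>real_of_int k\<bar> powr x)"
    unfolding sum_distrib_left by (intro sum.cong) (auto simp: freq_weight_def)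
  also have "\<dots> \<le> g * (2 * real_zeta x)"
    using assms by (intro mult_left_mono sum_inverse_powr_int_le) auto
  finally show ?thesis by simp
qed

text \<open>A finite set of vectors lies in the product of its coordinate projections, over which
  the sum of products factorizes into one-dimensional sums.\<close>

lemma sum_prod_freq_weight_le:
  fixes l :: nat
  assumes x: "1 < x" and g: "\<And>j. j \<in> {1..l} \<Longrightarrow> 0 \<le> g j"
    and F: "finite F" "F \<subseteq> {1..l} \<rightarrow>\<^sub>E UNIV"
  shows "(\<Sum>k\<in>F. \<Prod>j\<in>{1..l}. freq_weight x (g j) (k j)) \<le> (\<Prod>j\<in>{1..l}. 1 + g j * (2 * real_zeta x))"
proof -
  define B where "B j = (\<lambda>k. k j) ` F" for j
  have finB: "finite (B j)" for j using F by (simp add: B_def)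
  have "F \<subseteq> PiE {1..l} B" using F(2) by (force simp: B_def PiE_def)
  then have "(\<Sum>k\<in>F. \<Prod>j\<in>{1..l}. freq_weight x (g j) (k j)) \<le>
      (\<Sum>k\<in>PiE {1..l} B. \<Prod>j\<in>{1..l}. freq_weight x (g j) (k j))"
    using g finB by (intro sum_mono2 finite_PiE prod_nonneg) (auto intro: freq_weight_nonneg)
  also have "\<dots> = (\<Prod>j\<in>{1..l}. \<Sum>m\<in>B j. freq_weight x (g j) m)"
    using finB by (intro prod_sum_PiE[symmetric]) auto
  also have "\<dots> \<le> (\<Prod>j\<in>{1..l}. 1 + g j * (2 * real_zeta x))"
    using g finB x by (intro prod_mono) (auto intro!: sum_nonneg freq_weight_nonneg sum_freq_weight_le)
  finally show ?thesis .
qed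

lemma sum_freq_weight_multiples_le:
  assumes x: "1 < x" and g: "0 \<le> g" and B: "finite B" "0 \<notin> B" and N: "0 < N"
  shows "(\<Sum>m | m \<in> B \<and> int N dvd m. real (N - 1) * freq_weight x g m) \<le> g * (2 * real_zeta x)"
proof -
  define B' where "B' = (\<lambda>m. m div int N) ` {m. m \<in> B \<and> int N dvd m}"
  have inj: "inj_on (\<lambda>m. m div int N) {m. m \<in> B \<and> int N dvd m}"
    using N by (auto simp: inj_on_def dvd_div_eq_iff)
  have "(\<Sum>m | m \<in> B \<and> int N dvd m. real (N - 1) * freq_weight x g m) \<le>
      (\<Sum>m | m \<in> B \<and> int N dvd m. g * (1 / \<bar>real_of_int (m div int N)\<bar> powr x))"
  proof (intro sum_mono)
    fix m assume m: "m \<in> {m. m \<in> B \<and> int N dvd m}"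
    then obtain q where q: "m = int N * q" by (auto elim: dvdE)
    have q0: "q \<noteq> 0" using m q B by auto
    have mq: "m div int N = q" using q N by simp
    have "real N powr 1 \<le> real N powr x" using N x by (intro powr_mono) auto
    then have le: "real (N - 1) \<le> real N powr x" using N by simp
    have "freq_weight x g m = g / (real N powr x * \<bar>real_of_int q\<bar> powr x)"
      using q q0 N by (simp add: freq_weight_def abs_mult powr_mult)
    then have "real (N - 1) * freq_weight x g m = (real (N - 1) / real N powr x) * (g / \<bar>real_of_int q\<bar> powr x)"
      by simp
    also have "\<dots> \<le> 1 * (g / \<bar>real_of_int q\<bar> powr x)"
      using le N g by (intro mult_right_mono) (auto simp: divide_simps)
    finally show "real (N - 1) * freq_weight x g m \<le> g * (1 / \<bar>real_of_int (m div int N)\<bar> powr x)"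
      using mq by simp
  qed
  also have "\<dots> = g * (\<Sum>q\<in>B'. 1 / \<bar>real_of_int q\<bar> powr x)"
    unfolding B'_def sum.reindex[OF inj] sum_distrib_left o_def ..
  also have "\<dots> \<le> g * (2 * real_zeta x)"
  proof (intro mult_left_mono sum_inverse_powr_int_le x g)
    show "finite B'" using B by (simp add: B'_def)
    show "0 \<notin> B'" using B N by (auto simp: B'_def elim!: dvdE)
  qed
  finally show ?thesis .
qed

section \<open>Averaging over the candidates for one component\<close>

lemma card_zero_residues_le_1:
  assumes N: "prime N" and m: "\<not> int N dvd m"
  shows "card {\<zeta> \<in> {1..<N}. int N dvd c + m * int \<zeta>} \<le> 1"
proof -
  have "a = b" if a: "a \<in> {1..<N}" "int N dvd c + m * int a" and b: "b \<in> {1..<N}" "int N dvd c + m * int b" for a b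
  proof -
    have "int N dvd m * (int a - int b)"
      using dvd_diff[OF a(2) b(2)] by (simp add: algebra_simps)
    then have "int N dvd int a - int b"
      using m N prime_dvd_mult_iff[of "int N" m] by simp
    then show ?thesis using a b
      by (metis atLeastLessThan_iff int_ops(9) mod_eq_dvd_iff mod_less of_nat_eq_iff)
  qed
  then show ?thesis
    using card_le_Suc0_iff_eq[of "{\<zeta> \<in> {1..<N}. int N dvd c + m * int \<zeta>}"] by auto
qed

lemma zero_residues_multiple_iff:
  assumes N: "prime N" and c: "int N dvd c" and \<zeta>: "\<zeta> \<in> {1..<N}"
  shows "int N dvd c + m * int \<zeta> \<longleftrightarrow> int N dvd m"
proof -
  have "\<not> int N dvd int \<zeta>" using \<zeta> by (auto dest: nat_dvd_not_less)
  then show ?thesis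
    using N c dvd_add_right_iff[OF c] prime_dvd_mult_iff[of "int N" m "int \<zeta>"] by auto
qed

text \<open>If \<open>N\<close> divides \<open>c\<close>, only multiples of \<open>N\<close> contribute, each with \<open>N - 1\<close> residues, and this factor
  is compensated by \<open>N powr x\<close>; otherwise every \<open>m\<close> contributes at most one residue.\<close>

lemma sum_freq_weight_card_zero_residues_le:
  assumes x: "1 < x" and g: "0 \<le> g" and B: "finite B" "0 \<notin> B" and N: "prime N"
  shows "(\<Sum>m\<in>B. freq_weight x g m * real (card {\<zeta> \<in> {1..<N}. int N dvd c + m * int \<zeta>})) \<le> g * (2 * real_zeta x)"
proof (cases "int N dvd c")
  case True
  have "(\<Sum>m\<in>B. freq_weight x g m * real (card {\<zeta> \<in> {1..<N}. int N dvd c + m * int \<zeta>})) =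
      (\<Sum>m\<in>B. if int N dvd m then real (N - 1) * freq_weight x g m else 0)"
  proof (intro sum.cong refl)
    fix m
    have "{\<zeta> \<in> {1..<N}. int N dvd c + m * int \<zeta>} = (if int N dvd m then {1..<N} else {})"
      using zero_residues_multiple_iff[OF N True] by auto
    then show "freq_weight x g m * real (card {\<zeta> \<in> {1..<N}. int N dvd c + m * int \<zeta>}) =
      (if int N dvd m then real (N - 1) * freq_weight x g m else 0)" by simp
  qed
  also have "\<dots> = (\<Sum>m | m \<in> B \<and> int N dvd m. real (N - 1) * freq_weight x g m)"
    using B by (simp only: sum.inter_filter)
  also have "\<dots> \<le> g * (2 * real_zeta x)"
    using assms prime_gt_0_nat by (intro sum_freq_weight_multiples_le) auto
  finally show ?thesis .
next
  case False
  have "(\<Sum>m\<in>B. freq_weight x g m * real (card {\<zeta> \<in> {1..<N}. int N dvd c + m * int \<zeta>})) \<le>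
     (\<Sum>m\<in>B. g * (1 / \<bar>real_of_int m\<bar> powr x))"
  proof (intro sum_mono)
    fix m assume "m \<in> B"
    then have m0: "m \<noteq> 0" using B by auto
    have "card {\<zeta> \<in> {1..<N}. int N dvd c + m * int \<zeta>} \<le> 1"
    proof (cases "int N dvd m")
      case True
      then have "{\<zeta> \<in> {1..<N}. int N dvd c + m * int \<zeta>} = {}"
        using False by (auto simp: dvd_add_left_iff)
      then show ?thesis by (metis card.empty zero_le_one)
    qed (rule card_zero_residues_le_1[OF N])
    then have "freq_weight x g m * real (card {\<zeta> \<in> {1..<N}. int N dvd c + m * int \<zeta>}) \<le> freq_weight x g m * 1"
      using freq_weight_nonneg[OF g] by (intro mult_left_mono) auto
    then show "freq_weight x g m * real (card {\<zeta> \<in> {1..<N}. int N dvd c + m * int \<zeta>}) \<le> g * (1 / \<bar>real_of_int m\<bar> powr x)"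
      using m0 by (simp add: freq_weight_def)
  qed
  also have "\<dots> \<le> g * (2 * real_zeta x)"
    unfolding sum_distrib_left[symmetric] using assms by (intro mult_left_mono sum_inverse_powr_int_le) auto
  finally show ?thesis .
qed

lemma sum_PiE_insert:
  assumes "i \<notin> S"
  shows "(\<Sum>k\<in>PiE (insert i S) B. f k) = (\<Sum>k\<in>PiE S B. \<Sum>m\<in>B i. f (k(i := m)))"
proof -
  have "PiE (insert i S) B = (\<lambda>(k, m). k(i := m)) ` (PiE S B \<times> B i)"
    unfolding PiE_insert_eq by (subst swap_product [symmetric]) (simp add: image_image case_prod_unfold)
  then show ?thesis
    using inj_combinator'[OF assms, of B]
    by (simp add: sum.reindex sum.cartesian_product case_prod_unfold)
qed

text \<open>Exchanging the sums counts, for each \<open>k\<close>, the candidates that put it into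
  the dual lattice. The earlier coordinates enter this count only through the value
  \<open>?c k\<close>, and the bound for the sum over the last coordinate is uniform in that value;
  the earlier coordinates are then summed independently.\<close>

lemma sum_freq_weight_dual_le:
  assumes x: "1 < x" and g: "\<And>j. j \<in> {1..Suc l} \<Longrightarrow> 0 \<le> g j"
    and F: "finite F" "F \<subseteq> {k \<in> {1..Suc l} \<rightarrow>\<^sub>E UNIV. k (Suc l) \<noteq> 0}" and N: "prime N"
  shows "(\<Sum>\<zeta>\<in>{1..<N}. \<Sum>k\<in>F \<inter> dual_lattice (Suc l) N (z(Suc l := \<zeta>)). \<Prod>j\<in>{1..Suc l}. freq_weight x (g j) (k j))
    \<le> g (Suc l) * (2 * real_zeta x) * (\<Prod>j\<in>{1..l}. 1 + g j * (2 * real_zeta x))"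
proof -
  let ?b = "\<lambda>l k. \<Prod>j\<in>{1..l}. freq_weight x (g j) (k j)"
  let ?c = "\<lambda>k. \<Sum>j\<in>{1..l}. k j * int (z j)"
  let ?cnt = "\<lambda>k m. card {\<zeta> \<in> {1..<N}. int N dvd ?c k + m * int \<zeta>}"
  define B where "B j = (\<lambda>k. k j) ` F" for j
  have finB: "finite (B j)" for j using F by (simp add: B_def)
  have B0: "0 \<notin> B (Suc l)" using F by (auto simp: B_def)
  have FB: "F \<subseteq> PiE {1..Suc l} B" using F(2) by (force simp: B_def PiE_def)
  have split: "{1..Suc l} = insert (Suc l) {1..l}" by auto
  have bnn: "0 \<le> ?b (Suc l) k" for k using g by (intro prod_nonneg freq_weight_nonneg) auto
  have sum_split: "(\<Sum>j\<in>{1..Suc l}. k j * int ((z(Suc l := \<zeta>)) j)) = ?c k + k (Suc l) * int \<zeta>" for k \<zeta>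
    by simp
  have "(\<Sum>\<zeta>\<in>{1..<N}. \<Sum>k\<in>F \<inter> dual_lattice (Suc l) N (z(Suc l := \<zeta>)). ?b (Suc l) k) =
      (\<Sum>\<zeta>\<in>{1..<N}. \<Sum>k\<in>F. if int N dvd ?c k + k (Suc l) * int \<zeta> then ?b (Suc l) k else 0)"
  proof (rule sum.cong[OF refl])
    fix \<zeta>
    have "F \<inter> dual_lattice (Suc l) N (z(Suc l := \<zeta>)) = {k\<in>F. int N dvd ?c k + k (Suc l) * int \<zeta>}"
      unfolding dual_lattice_def sum_split using F(2) by auto
    then show "(\<Sum>k\<in>F \<inter> dual_lattice (Suc l) N (z(Suc l := \<zeta>)). ?b (Suc l) k) =
      (\<Sum>k\<in>F. if int N dvd ?c k + k (Suc l) * int \<zeta> then ?b (Suc l) k else 0)"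
      using F(1) by (simp only: sum.inter_filter)
  qed
  also have "\<dots> = (\<Sum>k\<in>F. \<Sum>\<zeta>\<in>{1..<N}. if int N dvd ?c k + k (Suc l) * int \<zeta> then ?b (Suc l) k else 0)"
    by (rule sum.swap)
  also have "\<dots> = (\<Sum>k\<in>F. ?b (Suc l) k * real (?cnt k (k (Suc l))))"
    by (intro sum.cong refl) (simp only: sum.inter_filter[symmetric] finite_atLeastLessThan sum_constant mult.commute)
  also have "\<dots> \<le> (\<Sum>k\<in>PiE {1..Suc l} B. ?b (Suc l) k * real (?cnt k (k (Suc l))))"
    using bnn FB finB by (intro sum_mono2 finite_PiE mult_nonneg_nonneg) auto
  also have "\<dots> = (\<Sum>k\<in>PiE {1..l} B. \<Sum>m\<in>B (Suc l). ?b l k * (freq_weight x (g (Suc l)) m * real (?cnt k m)))"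
  proof -
    have "?b (Suc l) (k(Suc l := m)) = ?b l k * freq_weight x (g (Suc l)) m" for k m by simp
    moreover have "?c (k(Suc l := m)) = ?c k" for k m by (intro sum.cong) auto
    ultimately show ?thesis
      unfolding split by (subst sum_PiE_insert) (auto simp: mult_ac)
  qed
  also have "\<dots> = (\<Sum>k\<in>PiE {1..l} B. ?b l k * (\<Sum>m\<in>B (Suc l). freq_weight x (g (Suc l)) m * real (?cnt k m)))"
    by (simp only: sum_distrib_left)
  also have "\<dots> \<le> (\<Sum>k\<in>PiE {1..l} B. ?b l k * (g (Suc l) * (2 * real_zeta x)))"
    using g finB B0 x N
    by (intro sum_mono mult_left_mono sum_freq_weight_card_zero_residues_le prod_nonneg freq_weight_nonneg) auto
  also have "\<dots> = (\<Sum>k\<in>PiE {1..l} B. ?b l k) * (g (Suc l) * (2 * real_zeta x))"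
    by (simp only: sum_distrib_right)
  also have "\<dots> \<le> (\<Prod>j\<in>{1..l}. 1 + g j * (2 * real_zeta x)) * (g (Suc l) * (2 * real_zeta x))"
    using g finB real_zeta_nonneg[OF x] x
    by (intro mult_right_mono sum_prod_freq_weight_le finite_PiE) auto
  finally show ?thesis by (simp add: mult_ac)
qed

section \<open>Jensen's inequality for powers at most one\<close>

text \<open>After division by x + y both summands lie in [0, 1], where t \<le> t^p for p \<le>
  1.\<close>

lemma powr_add_le_add_powr:
  fixes x y :: real
  assumes "0 \<le> x" "0 \<le> y" "0 < p" "p \<le> 1"
  shows "(x + y) powr p \<le> x powr p + y powr p"
proof (cases "x + y = 0")
  case False
  then have s: "0 < x + y" using assms by linarith
  have le: "t / (x + y) \<le> (t / (x + y)) powr p" if "0 \<le> t" "t \<le> x + y" for t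
    using powr_mono'[of p 1 "t / (x + y)"] that s assms by simp
  have "1 = x / (x + y) + y / (x + y)" using s by (simp add: add_divide_distrib[symmetric])
  also have "\<dots> \<le> (x / (x + y)) powr p + (y / (x + y)) powr p"
    using assms by (intro add_mono le) auto
  also have "\<dots> = (x powr p + y powr p) / (x + y) powr p"
    using assms by (simp add: powr_divide add_divide_distrib)
  finally show ?thesis using s by (simp add: divide_simps)
qed (use assms in auto)

lemma sum_powr_le_sum_powr:
  fixes f :: "'a \<Rightarrow> real"
  assumes "finite F" "\<And>k. k \<in> F \<Longrightarrow> 0 \<le> f k" "0 < p" "p \<le> 1"
  shows "(\<Sum>k\<in>F. f k) powr p \<le> (\<Sum>k\<in>F. f k powr p)"
  using assms(1,2)
proof (induction F rule: finite_induct)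
  case (insert a F)
  have "(\<Sum>k\<in>insert a F. f k) powr p = (f a + (\<Sum>k\<in>F. f k)) powr p" using insert by simp
  also have "\<dots> \<le> f a powr p + (\<Sum>k\<in>F. f k) powr p"
    using insert assms by (intro powr_add_le_add_powr sum_nonneg) auto
  also have "\<dots> \<le> f a powr p + (\<Sum>k\<in>F. f k powr p)" using insert by (intro add_left_mono) auto
  finally show ?case using insert by simp
qed auto

text \<open>The finite inequality is raised to the power 1 / p to become a bound for
  \<open>sum f F\<close> itself, since a common bound on the finite sums bounds the infinite
  sum.\<close>

lemma infsum_powr_le_infsum_powr:
  fixes f :: "'a \<Rightarrow> real"
  assumes nn: "\<And>k. k \<in> A \<Longrightarrow> 0 \<le> f k" and p: "0 < p" "p \<le> 1"
    and sf: "f summable_on A" and sp: "(\<lambda>k. f k powr p) summable_on A"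
  shows "(\<Sum>\<^sub>\<infinity>k\<in>A. f k) powr p \<le> (\<Sum>\<^sub>\<infinity>k\<in>A. f k powr p)"
proof -
  let ?S = "\<Sum>\<^sub>\<infinity>k\<in>A. f k powr p"
  have S: "0 \<le> ?S" by (intro infsum_nonneg) auto
  have "infsum f A \<le> ?S powr (1 / p)"
  proof (rule infsum_le_finite_sums[OF sf])
    fix F assume F: "finite F" "F \<subseteq> A"
    then have Fnn: "0 \<le> sum f F" using nn by (intro sum_nonneg) auto
    have "sum f F powr p \<le> (\<Sum>k\<in>F. f k powr p)"
      using F nn p by (intro sum_powr_le_sum_powr) auto
    also have "\<dots> \<le> ?S" using F sp by (intro finite_sum_le_infsum) auto
    finally have "(sum f F powr p) powr (1 / p) \<le> ?S powr (1 / p)"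
      using p by (intro powr_mono2) auto
    then show "sum f F \<le> ?S powr (1 / p)" using p Fnn by (simp add: powr_powr)
  qed
  then have "infsum f A powr p \<le> (?S powr (1 / p)) powr p"
    using nn p by (intro powr_mono2 infsum_nonneg) auto
  then show ?thesis using S p by (simp add: powr_powr)
qed

lemma summable_on_prod_freq_weight:
  fixes l :: nat
  assumes x: "1 < x" and g: "\<And>j. j \<in> {1..l} \<Longrightarrow> 0 \<le> g j" and A: "A \<subseteq> {1..l} \<rightarrow>\<^sub>E UNIV"
  shows "(\<lambda>k. \<Prod>j\<in>{1..l}. freq_weight x (g j) (k j)) summable_on A"
proof (rule nonneg_bdd_above_summable_on)
  show "0 \<le> (\<Prod>j\<in>{1..l}. freq_weight x (g j) (k j))" for k
    using g by (intro prod_nonneg freq_weight_nonneg) auto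
  show "bdd_above (sum (\<lambda>k. \<Prod>j\<in>{1..l}. freq_weight x (g j) (k j)) ` {F. F \<subseteq> A \<and> finite F})"
  proof (rule bdd_aboveI2)
    fix F assume "F \<in> {F. F \<subseteq> A \<and> finite F}"
    then show "(\<Sum>k\<in>F. \<Prod>j\<in>{1..l}. freq_weight x (g j) (k j)) \<le> (\<Prod>j\<in>{1..l}. 1 + g j * (2 * real_zeta x))"
      using A by (intro sum_prod_freq_weight_le x g) auto
  qed
qed

section \<open>Bound for the criterion by induction on the dimension\<close>

text \<open>lam \<ge> 1/2 makes the Jensen exponent 1 / (2 lam) at most 1, and lam < \<alpha> makes
  the resulting zeta argument \<alpha> / lam exceed 1.\<close>

locale lattice_weights =
  fixes \<alpha> lam :: real and \<gamma> :: "nat \<Rightarrow> real" and N :: nat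
  assumes alpha: "1 / 2 < \<alpha>" and lam: "1 / 2 \<le> lam" "lam < \<alpha>"
    and gamma: "\<And>j. j \<ge> 1 \<Longrightarrow> 0 \<le> \<gamma> j" and N: "prime N"
begin

text \<open>Bounds the sum of \<open>inv_sq l k powr (1 / (2 * lam))\<close> over all frequencies of
  dimension \<open>l\<close>. Removing the zero frequency gives \<open>G l - 1\<close>, which for
  dimension \<open>s\<close> is the sum over nonempty \<open>u\<close> in the theorem.\<close>

definition G :: "nat \<Rightarrow> real" where
  "G l = (\<Prod>j\<in>{1..l}. 1 + \<gamma> j powr (1 / lam) * (2 * real_zeta (\<alpha> / lam)))"

abbreviation "inv_sq l k \<equiv> 1 / (r_weight \<alpha> \<gamma> l k)\<^sup>2"

text \<open>What the choice of \<zeta> as component \<open>Suc l\<close> adds to the criterion. The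
  rest of \<open>R_crit\<close> is independent of \<zeta>, so ranking candidates by
  \<open>R_crit\<close> or by \<open>theta\<close> is the same.\<close>

definition theta :: "nat \<Rightarrow> (nat \<Rightarrow> nat) \<Rightarrow> nat \<Rightarrow> real" where
  "theta l z \<zeta> = (\<Sum>\<^sub>\<infinity>k\<in>{k \<in> dual_lattice (Suc l) N (z(Suc l := \<zeta>)). k (Suc l) \<noteq> 0}. inv_sq (Suc l) k)"

lemma exponent_gt_1: "1 < \<alpha> / lam"
  using lam by simp

lemma inv_sq_eq_powr: "inv_sq l k = (1 / r_weight \<alpha> \<gamma> l k) powr 2"
  using r_weight_nonneg[of l \<gamma> \<alpha> k] gamma by (simp add: power_divide)

lemma inv_sq_eq: "inv_sq l k = (\<Prod>j\<in>{1..l}. freq_weight (\<alpha> * 2) (\<gamma> j powr 2) (k j))"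
  unfolding inv_sq_eq_powr using gamma by (intro inverse_r_weight_powr) auto

lemma inv_sq_powr: "inv_sq l k powr (1 / (2 * lam)) =
  (\<Prod>j\<in>{1..l}. freq_weight (\<alpha> / lam) (\<gamma> j powr (1 / lam)) (k j))"
proof -
  have "inv_sq l k powr (1 / (2 * lam)) = (1 / r_weight \<alpha> \<gamma> l k) powr (1 / lam)"
    unfolding inv_sq_eq_powr using lam by (simp add: powr_powr)
  also have "\<dots> = (\<Prod>j\<in>{1..l}. freq_weight (\<alpha> * (1 / lam)) (\<gamma> j powr (1 / lam)) (k j))"
    using gamma by (intro inverse_r_weight_powr) auto
  finally show ?thesis by simp
qed

lemma inv_sq_summable: "A \<subseteq> {1..l} \<rightarrow>\<^sub>E UNIV \<Longrightarrow> inv_sq l summable_on A"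
  unfolding inv_sq_eq by (rule summable_on_prod_freq_weight) (use alpha in auto)

lemma inv_sq_powr_summable:
  "A \<subseteq> {1..l} \<rightarrow>\<^sub>E UNIV \<Longrightarrow> (\<lambda>k. inv_sq l k powr (1 / (2 * lam))) summable_on A"
  unfolding inv_sq_powr by (rule summable_on_prod_freq_weight[OF exponent_gt_1]) auto

lemma G_ge_1: "1 \<le> G l"
  unfolding G_def using real_zeta_nonneg[OF exponent_gt_1] by (intro prod_ge_1) auto

lemma R_crit_nonneg: "0 \<le> R_crit \<alpha> \<gamma> l M z"
  unfolding R_crit_def by (intro infsum_nonneg) auto

lemma theta_nonneg: "0 \<le> theta l z \<zeta>"
  unfolding theta_def by (intro infsum_nonneg) auto

text \<open>Dual vectors with last coordinate 0 do not see \<zeta>: they are the dual vectors of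
  dimension \<open>l\<close> padded with a 0.\<close>

lemma R_crit_Suc:
  "R_crit \<alpha> \<gamma> (Suc l) N (z(Suc l := \<zeta>)) = R_crit \<alpha> \<gamma> l N z + theta l z \<zeta>"
proof -
  let ?D = "dual_lattice (Suc l) N (z(Suc l := \<zeta>)) - {\<lambda>j\<in>{1..Suc l}. 0}"
  let ?Z = "{k \<in> ?D. k (Suc l) = 0}"
  let ?W = "{k \<in> dual_lattice (Suc l) N (z(Suc l := \<zeta>)). k (Suc l) \<noteq> 0}"
  have "(\<lambda>j\<in>{1..Suc l}. 0 :: int) (Suc l) = 0" by simp
  then have ne: "k \<noteq> (\<lambda>j\<in>{1..Suc l}. 0)" if "k (Suc l) \<noteq> 0" for k :: "nat \<Rightarrow> int"
    using that by metis
  have D: "?D = ?Z \<union> ?W"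
  proof (rule set_eqI)
    fix k
    show "k \<in> ?D \<longleftrightarrow> k \<in> ?Z \<union> ?W"
      using ne[of k] by (cases "k (Suc l) = 0") simp_all
  qed
  have sub: "dual_lattice (Suc l) N (z(Suc l := \<zeta>)) \<subseteq> {1..Suc l} \<rightarrow>\<^sub>E UNIV"
    by (auto simp: dual_lattice_def)
  have "R_crit \<alpha> \<gamma> (Suc l) N (z(Suc l := \<zeta>)) = infsum (inv_sq (Suc l)) (?Z \<union> ?W)"
    unfolding R_crit_def D[symmetric] ..
  also have "\<dots> = infsum (inv_sq (Suc l)) ?Z + infsum (inv_sq (Suc l)) ?W"
    using sub by (intro infsum_Un_disjoint inv_sq_summable) auto
  also have "infsum (inv_sq (Suc l)) ?Z = infsum (inv_sq l) (dual_lattice l N z - {\<lambda>j\<in>{1..l}. 0})"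
  \<comment> \<open>Vectors are extensional, so at coordinate \<open>Suc l\<close> the two index
    sets differ by 0 against \<open>undefined\<close>.\<close>
  proof (rule infsum_reindex_bij_witness[of _ "\<lambda>k. k(Suc l := 0)" "\<lambda>k. k(Suc l := undefined)"])
    fix k assume k: "k \<in> ?Z"
    then have ext: "k \<in> {1..Suc l} \<rightarrow>\<^sub>E UNIV" and k0: "k (Suc l) = 0"
      and dv: "int N dvd (\<Sum>j\<in>{1..Suc l}. k j * int ((z(Suc l := \<zeta>)) j))"
      and ne: "k \<noteq> (\<lambda>j\<in>{1..Suc l}. 0)"
      by (auto simp: dual_lattice_def)
    show "(k(Suc l := undefined))(Suc l := 0) = k" using k0 by auto
    have "(\<Sum>j\<in>{1..Suc l}. k j * int ((z(Suc l := \<zeta>)) j)) = (\<Sum>j\<in>{1..l}. (k(Suc l := undefined)) j * int (z j))"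
      using k0 by simp
    then have "k(Suc l := undefined) \<in> dual_lattice l N z"
      using ext dv by (auto simp: dual_lattice_def PiE_def extensional_def)
    moreover have "k(Suc l := undefined) \<noteq> (\<lambda>j\<in>{1..l}. 0)"
    proof
      assume eq: "k(Suc l := undefined) = (\<lambda>j\<in>{1..l}. 0)"
      have "k j = (\<lambda>j\<in>{1..Suc l}. 0) j" for j
        using fun_cong[OF eq, of j] k0 by (cases "j = Suc l") (auto simp: restrict_def split: if_splits)
      then show False using ne by auto
    qed
    ultimately show "k(Suc l := undefined) \<in> dual_lattice l N z - {\<lambda>j\<in>{1..l}. 0}" by simp
    show "inv_sq l (k(Suc l := undefined)) = inv_sq (Suc l) k"
      unfolding inv_sq_eq using k0 by (simp add: freq_weight_def)
  next
    fix k assume k: "k \<in> dual_lattice l N z - {\<lambda>j\<in>{1..l}. 0}"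
    then have ext: "k \<in> {1..l} \<rightarrow>\<^sub>E UNIV" and dv: "int N dvd (\<Sum>j\<in>{1..l}. k j * int (z j))"
      and ne: "k \<noteq> (\<lambda>j\<in>{1..l}. 0)"
      by (auto simp: dual_lattice_def)
    show "(k(Suc l := 0))(Suc l := undefined) = k" using ext by (auto simp: PiE_def extensional_def)
    have "(\<Sum>j\<in>{1..Suc l}. (k(Suc l := 0)) j * int ((z(Suc l := \<zeta>)) j)) = (\<Sum>j\<in>{1..l}. k j * int (z j))"
      by simp
    then have "k(Suc l := 0) \<in> dual_lattice (Suc l) N (z(Suc l := \<zeta>))"
      using ext dv by (auto simp: dual_lattice_def PiE_def extensional_def)
    moreover have "k(Suc l := 0) \<noteq> (\<lambda>j\<in>{1..Suc l}. 0)"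
    proof
      assume eq: "k(Suc l := 0) = (\<lambda>j\<in>{1..Suc l}. 0)"
      have "k j = (\<lambda>j\<in>{1..l}. 0) j" for j
        using fun_cong[OF eq, of j] ext by (cases "j = Suc l") (auto simp: restrict_def PiE_def extensional_def split: if_splits)
      then show False using ne by auto
    qed
    ultimately show "k(Suc l := 0) \<in> ?Z" by simp
  qed
  finally show ?thesis by (simp only: R_crit_def theta_def)
qed

text \<open>Jensen's inequality moves the power inside each \<open>theta\<close>, leaving one sum
  over pairs of \<zeta> and \<open>k\<close>. A finite set of pairs is enlarged to all admissible
  pairs over its projection to the frequencies, so that the finite averaging bound applies. The
  resulting increments of \<open>G\<close> telescope over the dimension.\<close>

lemma sum_theta_powr_le:
  "(\<Sum>\<zeta>\<in>{1..<N}. theta l z \<zeta> powr (1 / (2 * lam))) \<le> G (Suc l) - G l"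
proof -
  let ?A = "\<lambda>\<zeta>. {k \<in> dual_lattice (Suc l) N (z(Suc l := \<zeta>)). k (Suc l) \<noteq> 0}"
  let ?b = "\<lambda>k. inv_sq (Suc l) k powr (1 / (2 * lam))"
  have sub: "?A \<zeta> \<subseteq> {1..Suc l} \<rightarrow>\<^sub>E UNIV" for \<zeta> by (auto simp: dual_lattice_def)
  have fin: "sum (\<lambda>(\<zeta>, k). ?b k) F \<le> G (Suc l) - G l" if F: "finite F" "F \<subseteq> Sigma {1..<N} ?A" for F
  proof -
    let ?K = "snd ` F"
    have mem: "k \<in> ?A \<zeta>" "\<zeta> \<in> {1..<N}" if "(\<zeta>, k) \<in> F" for \<zeta> k
      using subsetD[OF F(2) that] by simp_all
    have K: "finite ?K" "?K \<subseteq> {k \<in> {1..Suc l} \<rightarrow>\<^sub>E UNIV. k (Suc l) \<noteq> 0}"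
    proof -
      show "?K \<subseteq> {k \<in> {1..Suc l} \<rightarrow>\<^sub>E UNIV. k (Suc l) \<noteq> 0}"
      proof
        fix k assume "k \<in> ?K"
        then obtain \<zeta> where "(\<zeta>, k) \<in> F" by force
        then show "k \<in> {k \<in> {1..Suc l} \<rightarrow>\<^sub>E UNIV. k (Suc l) \<noteq> 0}"
          using mem(1) subsetD[OF sub[of \<zeta>]] by blast
      qed
    qed (use F in simp)
    have "sum (\<lambda>(\<zeta>, k). ?b k) F \<le> sum (\<lambda>(\<zeta>, k). ?b k) (SIGMA \<zeta>:{1..<N}. ?K \<inter> dual_lattice (Suc l) N (z(Suc l := \<zeta>)))"
    proof (intro sum_mono2)
      show "finite (SIGMA \<zeta>:{1..<N}. ?K \<inter> dual_lattice (Suc l) N (z(Suc l := \<zeta>)))"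
        using K(1) by (intro finite_SigmaI) auto
      show "F \<subseteq> (SIGMA \<zeta>:{1..<N}. ?K \<inter> dual_lattice (Suc l) N (z(Suc l := \<zeta>)))"
      proof
        fix p assume p: "p \<in> F"
        then have "(fst p, snd p) \<in> F" by simp
        from mem[OF this] p show "p \<in> (SIGMA \<zeta>:{1..<N}. ?K \<inter> dual_lattice (Suc l) N (z(Suc l := \<zeta>)))"
          by (simp add: mem_Sigma_iff[of "fst p" "snd p", simplified])
      qed
    qed (simp add: case_prod_unfold)
    also have "\<dots> = (\<Sum>\<zeta>\<in>{1..<N}. \<Sum>k\<in>?K \<inter> dual_lattice (Suc l) N (z(Suc l := \<zeta>)). ?b k)"
      using F by (intro sum.Sigma[symmetric]) auto
    also have "\<dots> \<le> \<gamma> (Suc l) powr (1 / lam) * (2 * real_zeta (\<alpha> / lam)) * G l"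
      unfolding inv_sq_powr G_def
      by (rule sum_freq_weight_dual_le[OF exponent_gt_1 _ K N]) auto
    also have "\<dots> = G (Suc l) - G l" by (simp add: G_def algebra_simps)
    finally show ?thesis .
  qed
  have summ: "(\<lambda>(\<zeta>, k). ?b k) summable_on Sigma {1..<N} ?A"
  proof (rule nonneg_bdd_above_summable_on)
    show "bdd_above (sum (\<lambda>(\<zeta>, k). ?b k) ` {F. F \<subseteq> Sigma {1..<N} ?A \<and> finite F})"
    proof (rule bdd_aboveI2)
      fix F assume "F \<in> {F. F \<subseteq> Sigma {1..<N} ?A \<and> finite F}"
      then show "sum (\<lambda>(\<zeta>, k). ?b k) F \<le> G (Suc l) - G l" using fin by simp
    qed
  qed (simp add: case_prod_unfold)
  have "(\<Sum>\<zeta>\<in>{1..<N}. theta l z \<zeta> powr (1 / (2 * lam))) \<le> (\<Sum>\<zeta>\<in>{1..<N}. infsum ?b (?A \<zeta>))"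
    unfolding theta_def using lam
    by (intro sum_mono infsum_powr_le_infsum_powr inv_sq_summable inv_sq_powr_summable sub) simp_all
  also have "\<dots> = infsum (\<lambda>(\<zeta>, k). ?b k) (Sigma {1..<N} ?A)"
    using infsum_Sigma'_banach[OF summ] by simp
  also have "\<dots> \<le> G (Suc l) - G l"
    by (rule infsum_le_finite_sums[OF summ fin])
  finally show ?thesis .
qed

text \<open>Markov's inequality: if at least \<open>c\<close> candidates are no better than the
  selected one, the power 1 / (2 lam) of its increment is at most the sum over all candidates
  divided by \<open>c\<close>. Subadditivity of that power adds this to the bound for dimension
  \<open>l\<close>.\<close>

lemma R_crit_step:
  assumes "0 < c" "c \<le> real (card {\<zeta> \<in> {1..<N}. R_crit \<alpha> \<gamma> (Suc l) N z \<le> R_crit \<alpha> \<gamma> (Suc l) N (z(Suc l := \<zeta>))})"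
    and IH: "R_crit \<alpha> \<gamma> l N z powr (1 / (2 * lam)) \<le> (G l - 1) / c"
  shows "R_crit \<alpha> \<gamma> (Suc l) N z powr (1 / (2 * lam)) \<le> (G (Suc l) - 1) / c"
proof -
  let ?p = "1 / (2 * lam)"
  have R: "R_crit \<alpha> \<gamma> (Suc l) N z = R_crit \<alpha> \<gamma> l N z + theta l z (z (Suc l))"
    using R_crit_Suc[of l z "z (Suc l)"] by simp
  let ?S = "{\<zeta> \<in> {1..<N}. theta l z (z (Suc l)) \<le> theta l z \<zeta>}"
  have "c * theta l z (z (Suc l)) powr ?p \<le> real (card ?S) * theta l z (z (Suc l)) powr ?p"
    using assms(2) unfolding R R_crit_Suc by (intro mult_right_mono) auto
  also have "\<dots> = (\<Sum>\<zeta>\<in>?S. theta l z (z (Suc l)) powr ?p)" by simp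
  also have "\<dots> \<le> (\<Sum>\<zeta>\<in>?S. theta l z \<zeta> powr ?p)"
    using lam theta_nonneg by (intro sum_mono powr_mono2) auto
  also have "\<dots> \<le> (\<Sum>\<zeta>\<in>{1..<N}. theta l z \<zeta> powr ?p)"
    by (intro sum_mono2) auto
  also have "\<dots> \<le> G (Suc l) - G l" by (rule sum_theta_powr_le)
  finally have th: "theta l z (z (Suc l)) powr ?p \<le> (G (Suc l) - G l) / c"
    using assms(1) by (simp add: field_simps)
  have "R_crit \<alpha> \<gamma> (Suc l) N z powr ?p \<le> R_crit \<alpha> \<gamma> l N z powr ?p + theta l z (z (Suc l)) powr ?p"
    unfolding R using lam theta_nonneg R_crit_nonneg by (intro powr_add_le_add_powr) auto
  also have "\<dots> \<le> (G l - 1) / c + (G (Suc l) - G l) / c"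
    using IH th by (rule add_mono)
  finally show ?thesis by (simp add: add_divide_distrib[symmetric])
qed

end

text \<open>An element at sorted position i < n has a key no larger than those of the
  \<open>length xs - i\<close> elements from position \<open>i\<close> on; i < n makes the
  inequality strict.\<close>

lemma card_ge_in_take_sort_key:
  fixes f :: "'a \<Rightarrow> 'b :: linorder"
  assumes "distinct xs" "y \<in> set (take n (sort_key f xs))"
  shows "length xs - n < card {x \<in> set xs. f y \<le> f x}"
proof -
  let ?ys = "sort_key f xs"
  obtain i where i: "i < n" "i < length ?ys" "y = ?ys ! i"
    using assms(2) by (auto simp: in_set_conv_nth)
  have "(\<lambda>j. ?ys ! j) ` {i..<length xs} \<subseteq> {x \<in> set xs. f y \<le> f x}"
  proof
    fix x assume "x \<in> (\<lambda>j. ?ys ! j) ` {i..<length xs}"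
    then obtain j where j: "i \<le> j" "j < length xs" "x = ?ys ! j" by auto
    have "map f ?ys ! i \<le> map f ?ys ! j"
      using j by (intro sorted_nth_mono) auto
    then have "f y \<le> f x" using i j by simp
    moreover have "x \<in> set ?ys" unfolding j(3) using j(2) by (intro nth_mem) auto
    ultimately show "x \<in> {x \<in> set xs. f y \<le> f x}" by simp
  qed
  moreover have "inj_on (\<lambda>j. ?ys ! j) {i..<length xs}"
    using assms(1) by (intro inj_on_nth) auto
  ultimately have "length xs - i \<le> card {x \<in> set xs. f y \<le> f x}"
    using card_inj_on_le[of "\<lambda>j. ?ys ! j" "{i..<length xs}" "{x \<in> set xs. f y \<le> f x}"] by simp
  then show ?thesis using i by simp
qed

lemma R_crit_cong:
  assumes "\<And>j. j \<in> {1..l} \<Longrightarrow> z j = z' j"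
  shows "R_crit \<alpha> \<gamma> l N z = R_crit \<alpha> \<gamma> l N z'"
proof -
  have "(\<Sum>j\<in>{1..l}. k j * int (z j)) = (\<Sum>j\<in>{1..l}. k j * int (z' j))" for k
    using assms by (intro sum.cong) auto
  then show ?thesis by (simp only: R_crit_def dual_lattice_def)
qed

context lattice_weights
begin

text \<open>In dimension one every candidate is invertible modulo \<open>N\<close>, so all have the
  same dual lattice. The prescribed component 1 thus enters the induction as if it had been
  selected.\<close>

lemma R_crit_first_component:
  assumes "\<zeta> \<in> {1..<N}"
  shows "R_crit \<alpha> \<gamma> 1 N (z(1 := \<zeta>)) = R_crit \<alpha> \<gamma> 1 N (z(1 := 1))"
proof -
  have "int N dvd k 1 * int \<zeta> \<longleftrightarrow> int N dvd k 1" for k :: "nat \<Rightarrow> int"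
    using zero_residues_multiple_iff[OF N, of 0 \<zeta> "k 1"] assms by simp
  then show ?thesis by (simp add: R_crit_def dual_lattice_def)
qed

lemma R_crit_cbc_le:
  assumes tau: "0 < \<tau>" "\<tau> < 1" and z: "z \<in> cbc_vectors s \<alpha> \<gamma> \<tau> N" and l: "l \<le> s"
  shows "R_crit \<alpha> \<gamma> l N z powr (1 / (2 * lam)) \<le> (G l - 1) / ((1 - \<tau>) * (real N - 1))"
  using l
proof (induction l)
  case 0
  have "dual_lattice 0 N z - {\<lambda>j\<in>{1..0}. 0} = {}" by (auto simp: dual_lattice_def)
  then have "R_crit \<alpha> \<gamma> 0 N z = 0" unfolding R_crit_def by (simp only: infsum_empty)
  then show ?case by (simp add: G_def)
next
  case (Suc l)
  have N2: "2 \<le> N" using N by (rule prime_ge_2_nat)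
  have z1: "z 1 = 1" using z by (simp add: cbc_vectors_def)
  show ?case
  proof (rule R_crit_step)
    show "0 < (1 - \<tau>) * (real N - 1)" using tau N2 by simp
    show "R_crit \<alpha> \<gamma> l N z powr (1 / (2 * lam)) \<le> (G l - 1) / ((1 - \<tau>) * (real N - 1))"
      using Suc by simp
    show "(1 - \<tau>) * (real N - 1) \<le> real (card {\<zeta> \<in> {1..<N}. R_crit \<alpha> \<gamma> (Suc l) N z \<le> R_crit \<alpha> \<gamma> (Suc l) N (z(Suc l := \<zeta>))})"
    proof (cases "l = 0")
      case True
      have "z = z(1 := 1)" using z1 by auto
      then have "{\<zeta> \<in> {1..<N}. R_crit \<alpha> \<gamma> (Suc l) N z \<le> R_crit \<alpha> \<gamma> (Suc l) N (z(Suc l := \<zeta>))} = {1..<N}"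
        using R_crit_first_component[of _ z] True by (metis (mono_tags, lifting) Collect_cong Collect_mem_eq One_nat_def order_refl)
      then show ?thesis using tau N2 by (simp add: mult_left_le_one_le of_nat_diff)
    next
      case False
      let ?n = "nat \<lceil>\<tau> * (real N - 1)\<rceil>"
      let ?f = "\<lambda>\<zeta>. R_crit \<alpha> \<gamma> (Suc l) N (z(Suc l := \<zeta>))"
      have "z (Suc l) \<in> set (take ?n (sort_key ?f [1..<N]))"
        using z Suc.prems False by (auto simp: cbc_vectors_def cbc_choices_def)
      then have "length [1..<N] - ?n < card {\<zeta> \<in> set [1..<N]. ?f (z (Suc l)) \<le> ?f \<zeta>}"
        by (intro card_ge_in_take_sort_key) auto
      then have cd: "N - 1 - ?n < card {\<zeta> \<in> {1..<N}. R_crit \<alpha> \<gamma> (Suc l) N z \<le> ?f \<zeta>}"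
        by simp
      \<comment> \<open>The ceiling exceeds its argument by less than 1, and the strict inequality
        in \<open>cd\<close> gains that 1 back.\<close>
      have "real ?n < \<tau> * (real N - 1) + 1" using tau N2 by (simp add: of_nat_nat) linarith
      then show ?thesis using cd by (simp add: algebra_simps)
    qed
  qed
qed

end

section \<open>Probability of the dual lattice\<close>

lemma inverse_r_weight_sq_le_R_crit:
  assumes "lattice_weights \<alpha> lam \<gamma> N" "h \<in> dual_lattice l N z" "h \<noteq> (\<lambda>j\<in>{1..l}. 0)"
  shows "1 / (r_weight \<alpha> \<gamma> l h)\<^sup>2 \<le> R_crit \<alpha> \<gamma> l N z"
proof -
  interpret lattice_weights \<alpha> lam \<gamma> N by fact
  have "sum (inv_sq l) {h} \<le> infsum (inv_sq l) (dual_lattice l N z - {\<lambda>j\<in>{1..l}. 0})"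
    using assms by (intro finite_sum_le_infsum inv_sq_summable) (auto simp: dual_lattice_def)
  then show ?thesis by (simp add: R_crit_def)
qed

text \<open>Multiplying out over subsets; the empty subset gives the subtracted 1. This identifies
  \<open>G s - 1\<close> with the sum in the theorem.\<close>

lemma prod_1_plus_eq_sum_Pow:
  fixes f :: "nat \<Rightarrow> real"
  assumes "finite A"
  shows "(\<Prod>j\<in>A. 1 + f j powr p * c) - 1 = (\<Sum>u\<in>Pow A - {{}}. (\<Prod>j\<in>u. f j) powr p * c ^ card u)"
proof -
  have "(\<Prod>j\<in>A. 1 + f j powr p * c) = (\<Prod>j\<in>A. f j powr p * c + 1)" by (simp add: add.commute)
  also have "\<dots> = (\<Sum>u\<in>Pow A. (\<Prod>j\<in>u. f j powr p * c) * (\<Prod>j\<in>A - u. 1))"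
    using assms by (rule prod_add)
  also have "\<dots> = (\<Sum>u\<in>Pow A. (\<Prod>j\<in>u. f j) powr p * c ^ card u)"
    by (simp add: prod.distrib prod_powr_distrib)
  also have "\<dots> = (\<Sum>u\<in>insert {} (Pow A - {{}}). (\<Prod>j\<in>u. f j) powr p * c ^ card u)"
    by (intro sum.cong) auto
  also have "\<dots> = 1 + (\<Sum>u\<in>Pow A - {{}}. (\<Prod>j\<in>u. f j) powr p * c ^ card u)"
    using assms by (subst sum.insert) auto
  finally show ?thesis by simp
qed

section \<open>Recursive structure of the sets of generating vectors\<close>

lemma nat_ceiling_le_pred:
  assumes "0 < \<tau>" "\<tau> < 1" "2 \<le> N"
  shows "nat \<lceil>\<tau> * (real N - 1)\<rceil> \<le> N - 1"
proof -
  have "\<tau> * (real N - 1) \<le> 1 * (real N - 1)" using assms by (intro mult_right_mono) auto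
  then have "\<tau> * (real N - 1) \<le> real_of_int (int (N - 1))" using assms by (simp add: of_nat_diff)
  then have "\<lceil>\<tau> * (real N - 1)\<rceil> \<le> int (N - 1)" by (simp only: ceiling_le_iff)
  then show ?thesis by linarith
qed

lemma cbc_choices_subset: "cbc_choices \<alpha> \<gamma> \<tau> N l z \<subseteq> {1..N - 1}"
  unfolding cbc_choices_def using set_take_subset by fastforce

text \<open>The size does not depend on \<open>z\<close>: every prefix has equally many extensions,
  which makes the uniform distribution on \<open>cbc_vectors\<close> agree with successive uniform
  choices.\<close>

lemma card_cbc_choices:
  assumes "0 < \<tau>" "\<tau> < 1" "2 \<le> N"
  shows "card (cbc_choices \<alpha> \<gamma> \<tau> N l z) = nat \<lceil>\<tau> * (real N - 1)\<rceil>"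
  unfolding cbc_choices_def using nat_ceiling_le_pred[OF assms] by (subst distinct_card) auto

lemma cbc_choices_cong:
  assumes "\<And>j. j \<in> {1..<l} \<Longrightarrow> z j = z' j"
  shows "cbc_choices \<alpha> \<gamma> \<tau> N l z = cbc_choices \<alpha> \<gamma> \<tau> N l z'"
proof -
  have "R_crit \<alpha> \<gamma> l N (z(l := \<zeta>)) = R_crit \<alpha> \<gamma> l N (z'(l := \<zeta>))" for \<zeta>
    using assms by (intro R_crit_cong) auto
  then show ?thesis by (simp only: cbc_choices_def)
qed

text \<open>Works because \<open>cbc_choices\<close> looks only at earlier components, so changing
  component \<open>Suc s\<close> affects none of the conditions on the prefix.\<close>

lemma cbc_vectors_Suc:
  assumes s: "1 \<le> s"
  shows "cbc_vectors (Suc s) \<alpha> \<gamma> \<tau> N =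
    (\<lambda>(z, \<zeta>). z(Suc s := \<zeta>)) ` (SIGMA z:cbc_vectors s \<alpha> \<gamma> \<tau> N. cbc_choices \<alpha> \<gamma> \<tau> N (Suc s) z)"
    (is "?L = ?f ` ?R")
proof
  show "?L \<subseteq> ?f ` ?R"
  proof
    fix z assume z: "z \<in> ?L"
    let ?z = "z(Suc s := undefined)"
    have ext: "z \<in> {1..Suc s} \<rightarrow>\<^sub>E {1..N - 1}" and z1: "z 1 = 1"
      and ch: "\<And>l. l \<in> {2..Suc s} \<Longrightarrow> z l \<in> cbc_choices \<alpha> \<gamma> \<tau> N l z"
      using z by (auto simp: cbc_vectors_def)
    have "cbc_choices \<alpha> \<gamma> \<tau> N l z = cbc_choices \<alpha> \<gamma> \<tau> N l ?z" if "l \<le> Suc s" for l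
      using that by (intro cbc_choices_cong) auto
    then have ch': "z l \<in> cbc_choices \<alpha> \<gamma> \<tau> N l ?z" if "l \<in> {2..Suc s}" for l
      using ch[OF that] that by auto
    have "?z \<in> {1..s} \<rightarrow>\<^sub>E {1..N - 1}" using ext by (auto simp: PiE_def extensional_def Pi_def)
    then have "?z \<in> cbc_vectors s \<alpha> \<gamma> \<tau> N"
      using z1 s ch' by (auto simp: cbc_vectors_def)
    moreover have "z (Suc s) \<in> cbc_choices \<alpha> \<gamma> \<tau> N (Suc s) ?z" using ch' s by auto
    ultimately have "(?z, z (Suc s)) \<in> ?R" by simp
    moreover have "?f (?z, z (Suc s)) = z" by simp
    ultimately show "z \<in> ?f ` ?R" by (metis imageI)
  qed
  show "?f ` ?R \<subseteq> ?L"
  proof clarify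
    fix z \<zeta> assume z: "z \<in> cbc_vectors s \<alpha> \<gamma> \<tau> N" and \<zeta>: "\<zeta> \<in> cbc_choices \<alpha> \<gamma> \<tau> N (Suc s) z"
    let ?z = "z(Suc s := \<zeta>)"
    have eq: "cbc_choices \<alpha> \<gamma> \<tau> N l ?z = cbc_choices \<alpha> \<gamma> \<tau> N l z" if "l \<le> Suc s" for l
      using that by (intro cbc_choices_cong) auto
    have "\<zeta> \<in> {1..N - 1}" using \<zeta> cbc_choices_subset by blast
    then have "?z \<in> {1..Suc s} \<rightarrow>\<^sub>E {1..N - 1}"
      using z by (auto simp: cbc_vectors_def PiE_def extensional_def Pi_def)
    moreover have "?z l \<in> cbc_choices \<alpha> \<gamma> \<tau> N l ?z" if "l \<in> {2..Suc s}" for l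
      using that z \<zeta> eq[of l] by (cases "l = Suc s") (auto simp: cbc_vectors_def)
    ultimately show "?z \<in> ?L"
      using z s by (auto simp: cbc_vectors_def)
  qed
qed

text \<open>The fibre \<open>C\<close> is arbitrary because the map is used both on all admissible
  last components and on those solving a congruence.\<close>

lemma inj_on_cbc_extend:
  "inj_on (\<lambda>(z, \<zeta>). z(Suc s := \<zeta>)) (SIGMA z:cbc_vectors s \<alpha> \<gamma> \<tau> N. C z)"
proof (rule inj_onI, clarify)
  fix z \<zeta> z' \<zeta>'
  assume z: "z \<in> cbc_vectors s \<alpha> \<gamma> \<tau> N" "z' \<in> cbc_vectors s \<alpha> \<gamma> \<tau> N"
    and eq: "z(Suc s := \<zeta>) = z'(Suc s := \<zeta>')"
  have "z j = z' j" for j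
    using z fun_cong[OF eq, of j]
    by (cases "j = Suc s") (auto simp: cbc_vectors_def PiE_def extensional_def)
  then show "z = z' \<and> \<zeta> = \<zeta>'" using fun_cong[OF eq, of "Suc s"] by auto
qed

lemma finite_cbc_vectors [simp]: "finite (cbc_vectors s \<alpha> \<gamma> \<tau> N)"
  by (rule finite_subset[of _ "{1..s} \<rightarrow>\<^sub>E {1..N - 1}"]) (auto simp: cbc_vectors_def intro: finite_PiE)

lemma finite_cbc_choices [simp]: "finite (cbc_choices \<alpha> \<gamma> \<tau> N l z)"
  by (simp add: cbc_choices_def)

text \<open>Conditionally on the components chosen before it, the last component \<open>z j\<close> with \<open>N\<close> not dividing
  \<open>h j\<close> is uniform on a set of \<open>\<lceil>\<tau> (N - 1)\<rceil>\<close> residues, at most one of which solves the congruence.\<close>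

lemma card_cbc_vectors_dual_le:
  assumes tau: "0 < \<tau>" "\<tau> < 1" and N: "prime N" and s: "1 \<le> s"
    and h: "j \<in> {1..s}" "\<not> int N dvd h j"
  shows "card {z \<in> cbc_vectors s \<alpha> \<gamma> \<tau> N. int N dvd (\<Sum>j\<in>{1..s}. h j * int (z j))} * nat \<lceil>\<tau> * (real N - 1)\<rceil>
    \<le> card (cbc_vectors s \<alpha> \<gamma> \<tau> N)"
  using s h
proof (induction s arbitrary: j rule: dec_induct)
  case base
  \<comment> \<open>As \<open>z 1 = 1\<close>, the congruence says that \<open>N\<close> divides
    \<open>h 1\<close>, contrary to the assumption on \<open>j\<close>.\<close>
  have "{z \<in> cbc_vectors 1 \<alpha> \<gamma> \<tau> N. int N dvd (\<Sum>j\<in>{1..1}. h j * int (z j))} = {}"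
    using base by (auto simp: cbc_vectors_def)
  then show ?case by (simp only: card.empty)
next
  case (step s)
  let ?n = "nat \<lceil>\<tau> * (real N - 1)\<rceil>"
  let ?V = "cbc_vectors s \<alpha> \<gamma> \<tau> N" and ?C = "cbc_choices \<alpha> \<gamma> \<tau> N (Suc s)"
  let ?c = "\<lambda>z::nat \<Rightarrow> nat. \<Sum>j\<in>{1..s}. h j * int (z j)"
  have N2: "2 \<le> N" using N by (rule prime_ge_2_nat)
  have sum_upd: "(\<Sum>j\<in>{1..Suc s}. h j * int ((z(Suc s := \<zeta>)) j)) = ?c z + h (Suc s) * int \<zeta>" for z \<zeta>
    by simp
  have "card (cbc_vectors (Suc s) \<alpha> \<gamma> \<tau> N) = card (SIGMA z:?V. ?C z)"
    unfolding cbc_vectors_Suc[OF step.hyps(1)] using inj_on_cbc_extend by (rule card_image)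
  also have "\<dots> = card ?V * ?n"
    by (simp add: card_cbc_choices[OF tau N2])
  finally have cardV: "card (cbc_vectors (Suc s) \<alpha> \<gamma> \<tau> N) = card ?V * ?n" .
  have "{z \<in> cbc_vectors (Suc s) \<alpha> \<gamma> \<tau> N. int N dvd (\<Sum>j\<in>{1..Suc s}. h j * int (z j))} =
      (\<lambda>(z, \<zeta>). z(Suc s := \<zeta>)) ` (SIGMA z:?V. {\<zeta> \<in> ?C z. int N dvd ?c z + h (Suc s) * int \<zeta>})"
    unfolding cbc_vectors_Suc[OF step.hyps(1)] using sum_upd by (force simp del: sum.cl_ivl_Suc)
  then have "card {z \<in> cbc_vectors (Suc s) \<alpha> \<gamma> \<tau> N. int N dvd (\<Sum>j\<in>{1..Suc s}. h j * int (z j))} =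
      card (SIGMA z:?V. {\<zeta> \<in> ?C z. int N dvd ?c z + h (Suc s) * int \<zeta>})"
    using card_image[OF inj_on_cbc_extend] by simp
  also have "\<dots> = (\<Sum>z\<in>?V. card {\<zeta> \<in> ?C z. int N dvd ?c z + h (Suc s) * int \<zeta>})"
    by simp
  finally have cardG: "card {z \<in> cbc_vectors (Suc s) \<alpha> \<gamma> \<tau> N. int N dvd (\<Sum>j\<in>{1..Suc s}. h j * int (z j))} =
      (\<Sum>z\<in>?V. card {\<zeta> \<in> ?C z. int N dvd ?c z + h (Suc s) * int \<zeta>})" .
  have "(\<Sum>z\<in>?V. card {\<zeta> \<in> ?C z. int N dvd ?c z + h (Suc s) * int \<zeta>}) \<le> card ?V"
  proof (cases "int N dvd h (Suc s)")
    case False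
    have "(\<Sum>z\<in>?V. card {\<zeta> \<in> ?C z. int N dvd ?c z + h (Suc s) * int \<zeta>}) \<le> (\<Sum>z\<in>?V. 1)"
    proof (intro sum_mono)
      fix z
      have "{\<zeta> \<in> ?C z. int N dvd ?c z + h (Suc s) * int \<zeta>} \<subseteq> {\<zeta> \<in> {1..<N}. int N dvd ?c z + h (Suc s) * int \<zeta>}"
        using cbc_choices_subset[of \<alpha> \<gamma> \<tau> N "Suc s" z] N2 by force
      then have "card {\<zeta> \<in> ?C z. int N dvd ?c z + h (Suc s) * int \<zeta>} \<le> card {\<zeta> \<in> {1..<N}. int N dvd ?c z + h (Suc s) * int \<zeta>}"
        by (intro card_mono) auto
      also have "\<dots> \<le> 1" by (rule card_zero_residues_le_1[OF N False])
      finally show "card {\<zeta> \<in> ?C z. int N dvd ?c z + h (Suc s) * int \<zeta>} \<le> 1" .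
    qed
    then show ?thesis by simp
  next
    case True
    \<comment> \<open>The last component drops out of the congruence, so \<open>j\<close> lies
      earlier and every solution of length \<open>s\<close> keeps all its \<open>?n\<close>
      extensions.\<close>
    then have j: "j \<in> {1..s}" using step.prems by (cases "j = Suc s") auto
    have "(\<Sum>z\<in>?V. card {\<zeta> \<in> ?C z. int N dvd ?c z + h (Suc s) * int \<zeta>}) = (\<Sum>z\<in>?V. if int N dvd ?c z then ?n else 0)"
    proof (intro sum.cong refl)
      fix z
      have "int N dvd ?c z + h (Suc s) * int \<zeta> \<longleftrightarrow> int N dvd ?c z" for \<zeta>
        using True by (simp add: dvd_add_left_iff)
      then have "{\<zeta> \<in> ?C z. int N dvd ?c z + h (Suc s) * int \<zeta>} = (if int N dvd ?c z then ?C z else {})" by auto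
      then show "card {\<zeta> \<in> ?C z. int N dvd ?c z + h (Suc s) * int \<zeta>} = (if int N dvd ?c z then ?n else 0)"
        using card_cbc_choices[OF tau N2] by simp
    qed
    also have "\<dots> = card {z \<in> ?V. int N dvd ?c z} * ?n"
      by (simp only: sum.inter_filter[symmetric] finite_cbc_vectors sum_constant) simp
    also have "\<dots> \<le> card ?V" by (rule step.IH[OF j step.prems(2)])
    finally show ?thesis .
  qed
  then show ?case unfolding cardG cardV by (rule mult_right_mono) simp
qed

section \<open>Probability bound for a fixed frequency\<close>

definition dual_prob ::
  "nat \<Rightarrow> real \<Rightarrow> (nat \<Rightarrow> real) \<Rightarrow> nat \<Rightarrow> real \<Rightarrow> (nat \<Rightarrow> int) \<Rightarrow> real" where
  "dual_prob s \<alpha> \<gamma> M \<tau> h = 1 / real (card (prime_pool M)) * (\<Sum>N\<in>prime_pool M.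
     1 / real (card (cbc_vectors s \<alpha> \<gamma> \<tau> N)) *
       real (card {z \<in> cbc_vectors s \<alpha> \<gamma> \<tau> N. int N dvd (\<Sum>j\<in>{1..s}. h j * int (z j))}))"

text \<open>When \<open>N\<close> fails to divide some \<open>h j\<close>, the choice of
  \<open>z\<close> gives at most the reciprocal of the number of choices per component, hence 2 /
  (\<tau> M); otherwise \<open>N\<close> divides \<open>h i\<close> and the bound is the trivial 1.
  In the proportion of the latter primes \<open>ln (real M)\<close> cancels.\<close>

lemma dual_prob_le:
  assumes tau: "0 < \<tau>" "\<tau> < 1" and s: "1 \<le> s" and M: "2 \<le> M"
    and c: "0 < c" "c * real M \<le> real (card (prime_pool M)) * ln (real M)"
    and h: "i \<in> {1..s}" "h i \<noteq> 0"
  shows "dual_prob s \<alpha> \<gamma> M \<tau> h \<le> 2 / (\<tau> * real M) + 2 * ln \<bar>real_of_int (h i)\<bar> / (c * real M)"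
proof -
  let ?P = "prime_pool M" and ?V = "cbc_vectors s \<alpha> \<gamma> \<tau>"
  let ?good = "\<lambda>N. {z \<in> ?V N. int N dvd (\<Sum>j\<in>{1..s}. h j * int (z j))}"
  let ?D = "{N \<in> ?P. N dvd nat \<bar>h i\<bar>}"
  have lnM: "0 < ln (real M)" using M by simp
  have "0 < c * real M" using c M by simp
  then have "0 < real (card ?P) * ln (real M)" using c(2) by linarith
  then have P: "0 < real (card ?P)" using lnM by (rule zero_less_mult_pos2)
  have pt: "1 / real (card (?V N)) * real (card (?good N)) \<le> 2 / (\<tau> * real M) + (if N \<in> ?D then 1 else 0)"
    if N: "N \<in> ?P" for N
  proof (cases "\<exists>j\<in>{1..s}. \<not> int N dvd h j")
    case True
    have prN: "prime N" using N by (simp add: prime_pool_def)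
    then have N2: "2 \<le> N" by (rule prime_ge_2_nat)
    let ?n = "nat \<lceil>\<tau> * (real N - 1)\<rceil>"
    have "\<tau> * (real M / 2) \<le> \<tau> * (real N - 1)"
      using prime_pool_gt[OF N] tau by (intro mult_left_mono) auto
    also have "\<dots> \<le> real ?n" by (rule real_nat_ceiling_ge)
    finally have n: "\<tau> * real M / 2 \<le> real ?n" by simp
    have tM: "0 < \<tau> * real M / 2" using tau M by simp
    obtain j where j: "j \<in> {1..s}" "\<not> int N dvd h j" using True by blast
    have "card (?good N) * ?n \<le> card (?V N)"
      using tau prN s j by (rule card_cbc_vectors_dual_le)
    then have le: "real (card (?good N)) * real ?n \<le> real (card (?V N))"
      by (simp only: of_nat_mult[symmetric] of_nat_le_iff)
    have "1 / real (card (?V N)) * real (card (?good N)) \<le> 1 / real ?n"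
    proof (cases "card (?V N) = 0")
      case False
      have "1 / v * g \<le> 1 / n" if "g * n \<le> v" "0 < n" "0 < v" for v g n :: real
        using that by (simp add: field_simps)
      from this[OF le] show ?thesis using False n tM by linarith
    qed simp
    also have "\<dots> \<le> 1 / (\<tau> * real M / 2)" using n tM by (intro divide_left_mono mult_pos_pos) linarith+
    also have "\<dots> = 2 / (\<tau> * real M)" by simp
    finally show ?thesis by simp
  next
    case False
    then have "int N dvd h i" using h by auto
    then have D: "N \<in> ?D" using N by (simp add: nat_dvd_iff[symmetric] dvd_nat_abs_iff)
    have "card (?good N) \<le> card (?V N)" by (intro card_mono) auto
    then have "1 / real (card (?V N)) * real (card (?good N)) \<le> 1" by (simp add: divide_simps)
    moreover have "0 \<le> 2 / (\<tau> * real M)" using tau by simp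
    ultimately show ?thesis unfolding if_P[OF D] by linarith
  qed
  have "(\<Sum>N\<in>?P. 1 / real (card (?V N)) * real (card (?good N))) \<le>
      (\<Sum>N\<in>?P. 2 / (\<tau> * real M) + (if N \<in> ?D then 1 else 0))"
    by (intro sum_mono pt)
  also have "\<dots> = real (card ?P) * (2 / (\<tau> * real M)) + real (card ?D)"
    by (simp add: sum.distrib sum.If_cases Int_def)
  finally have "dual_prob s \<alpha> \<gamma> M \<tau> h \<le> 1 / real (card ?P) * (real (card ?P) * (2 / (\<tau> * real M)) + real (card ?D))"
    unfolding dual_prob_def by (intro mult_left_mono) auto
  also have "\<dots> = 2 / (\<tau> * real M) + real (card ?D) / real (card ?P)"
    using P by (auto simp: distrib_left)
  also have "real (card ?D) / real (card ?P) \<le> 2 * ln \<bar>real_of_int (h i)\<bar> / (c * real M)"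
  proof -
    have "real (card ?D) * ln (real M) \<le> 2 * ln (real (nat \<bar>h i\<bar>))"
      using h M by (intro card_prime_divisors_pool_le) auto
    then have D: "real (card ?D) * ln (real M) \<le> 2 * ln \<bar>real_of_int (h i)\<bar>" by simp
    have hi: "1 \<le> \<bar>real_of_int (h i)\<bar>" using h by linarith
    have "(real (card ?D) * ln (real M)) * (c * real M) \<le> 2 * ln \<bar>real_of_int (h i)\<bar> * (real (card ?P) * ln (real M))"
      by (rule mult_mono[OF D c(2)]) (use hi \<open>0 < c * real M\<close> in auto)
    then have "(real (card ?D) * (c * real M)) * ln (real M) \<le> (2 * ln \<bar>real_of_int (h i)\<bar> * real (card ?P)) * ln (real M)"
      by (simp add: mult_ac)
    then have "real (card ?D) * (c * real M) \<le> 2 * ln \<bar>real_of_int (h i)\<bar> * real (card ?P)"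
      using lnM by (rule mult_right_le_imp_le)
    then show ?thesis using P \<open>0 < c * real M\<close> by (simp add: divide_simps mult_ac)
  qed
  finally show ?thesis by simp
qed

text \<open>Weights at most 1 make every factor at least 1, so the product dominates each single
  factor, which in turn dominates its numerator.\<close>

lemma r_weight_ge:
  assumes \<gamma>: "\<And>j. j \<in> {1..s} \<Longrightarrow> h j \<noteq> 0 \<Longrightarrow> 0 < \<gamma> j \<and> \<gamma> j \<le> 1"
    and alpha: "0 < \<alpha>" and i: "i \<in> {1..s}" "h i \<noteq> 0"
  shows "\<bar>real_of_int (h i)\<bar> powr \<alpha> \<le> r_weight \<alpha> \<gamma> s h"
proof -
  let ?S = "{j \<in> {1..s}. h j \<noteq> 0}"
  have ge: "\<bar>real_of_int (h j)\<bar> powr \<alpha> \<le> \<bar>real_of_int (h j)\<bar> powr \<alpha> / \<gamma> j" and ge1: "1 \<le> \<bar>real_of_int (h j)\<bar> powr \<alpha>"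
    if "j \<in> ?S" for j
  proof -
    show "\<bar>real_of_int (h j)\<bar> powr \<alpha> \<le> \<bar>real_of_int (h j)\<bar> powr \<alpha> / \<gamma> j"
      using \<gamma>[of j] that by (simp add: le_divide_eq mult_left_le)
    have "1 \<le> \<bar>real_of_int (h j)\<bar>" using that by auto
    then show "1 \<le> \<bar>real_of_int (h j)\<bar> powr \<alpha>" using alpha by (simp add: ge_one_powr_ge_zero)
  qed
  have "0 \<le> \<bar>real_of_int (h i)\<bar> powr \<alpha> / \<gamma> i"
    using i by (intro order_trans[OF powr_ge_zero ge]) auto
  then have "\<bar>real_of_int (h i)\<bar> powr \<alpha> * 1 \<le> (\<bar>real_of_int (h i)\<bar> powr \<alpha> / \<gamma> i) * (\<Prod>j\<in>?S - {i}. \<bar>real_of_int (h j)\<bar> powr \<alpha> / \<gamma> j)"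
    using ge[of i] i ge ge1 by (intro mult_mono prod_ge_1) (auto intro: order_trans)
  also have "\<dots> = r_weight \<alpha> \<gamma> s h"
    unfolding r_weight_def using i by (intro prod.remove[symmetric]) auto
  finally show ?thesis by simp
qed

text \<open>If \<open>h\<close> occurs for no prime and vector, its probability is 0. A single
  occurrence at some \<open>N\<close> and \<open>z\<close> already suffices for the other case: the
  term of \<open>h\<close> in \<open>R_crit\<close> then gives r^(-1/lam) \<le> Q for r =
  \<open>r_weight \<alpha> \<gamma> s h\<close>.\<close>

lemma dual_prob_le_r_weight:
  assumes tau: "0 < \<tau>" "\<tau> < 1" and s: "1 \<le> s" and M: "2 \<le> M"
    and c: "0 < c" "c * real M \<le> real (card (prime_pool M)) * ln (real M)"
    and alpha: "1 / 2 < \<alpha>" and lam: "1 / 2 \<le> lam" "lam < \<alpha>" and \<delta>: "0 < \<delta>" "\<delta> < 1"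
    and \<gamma>: "\<And>j. j \<ge> 1 \<Longrightarrow> 0 \<le> \<gamma> j \<and> \<gamma> j \<le> 1"
    and h: "h \<in> {1..s} \<rightarrow>\<^sub>E UNIV" "\<And>j. j \<in> {1..s} \<Longrightarrow> h j \<noteq> 0 \<Longrightarrow> \<gamma> j \<noteq> 0" "i \<in> {1..s}" "h i \<noteq> 0"
    and Q: "Q = 2 / ((1 - \<tau>) * real M) * (\<Sum>u\<in>Pow {1..s} - {{}}.
                 (\<Prod>j\<in>u. \<gamma> j) powr (1 / lam) * (2 * real_zeta (\<alpha> / lam)) ^ card u)"
  shows "dual_prob s \<alpha> \<gamma> M \<tau> h \<le>
    (2 + 2 / c) / (\<delta> * \<tau> * real M) * Q powr (2 * lam * (1 - \<delta> / (2 * \<alpha>))) * (r_weight \<alpha> \<gamma> s h)\<^sup>2"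
proof (cases "\<exists>N\<in>prime_pool M. \<exists>z\<in>cbc_vectors s \<alpha> \<gamma> \<tau> N. int N dvd (\<Sum>j\<in>{1..s}. h j * int (z j))")
  case False
  have "(\<Sum>N\<in>prime_pool M. 1 / real (card (cbc_vectors s \<alpha> \<gamma> \<tau> N)) *
       real (card {z \<in> cbc_vectors s \<alpha> \<gamma> \<tau> N. int N dvd (\<Sum>j\<in>{1..s}. h j * int (z j))})) = 0"
  proof (rule sum.neutral, rule ballI)
    fix N assume "N \<in> prime_pool M"
    then have "{z \<in> cbc_vectors s \<alpha> \<gamma> \<tau> N. int N dvd (\<Sum>j\<in>{1..s}. h j * int (z j))} = {}"
      using False by auto
    then show "1 / real (card (cbc_vectors s \<alpha> \<gamma> \<tau> N)) *
       real (card {z \<in> cbc_vectors s \<alpha> \<gamma> \<tau> N. int N dvd (\<Sum>j\<in>{1..s}. h j * int (z j))}) = 0"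
      by (simp only: card.empty of_nat_0 mult_zero_right)
  qed
  then have "dual_prob s \<alpha> \<gamma> M \<tau> h = 0" by (simp only: dual_prob_def mult_zero_right)
  then show ?thesis using c tau \<delta> by simp
next
  case True
  then obtain N z where NP: "N \<in> prime_pool M" and z: "z \<in> cbc_vectors s \<alpha> \<gamma> \<tau> N"
    and dv: "int N dvd (\<Sum>j\<in>{1..s}. h j * int (z j))" by blast
  let ?r = "r_weight \<alpha> \<gamma> s h"
  interpret lattice_weights \<alpha> lam \<gamma> N
    using alpha lam \<gamma> NP by unfold_locales (auto simp: prime_pool_def)
  have hd: "h \<in> dual_lattice s N z" using h dv by (simp add: dual_lattice_def)
  have h0: "h \<noteq> (\<lambda>j\<in>{1..s}. 0)" using h by auto
  have Gs: "Q = 2 / ((1 - \<tau>) * real M) * (G s - 1)"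
    unfolding Q G_def prod_1_plus_eq_sum_Pow[OF finite_atLeastAtMost] ..
  have hi1: "1 \<le> \<bar>real_of_int (h i)\<bar>" using h(4) by linarith
  have r_ge: "\<bar>real_of_int (h i)\<bar> powr \<alpha> \<le> ?r"
  proof (rule r_weight_ge)
    show "0 < \<gamma> j \<and> \<gamma> j \<le> 1" if "j \<in> {1..s}" "h j \<noteq> 0" for j
      using that h(2)[OF that] \<gamma>[of j] by auto
  qed (use alpha h in auto)
  have r1: "1 \<le> ?r"
    using r_ge hi1 alpha by (intro order_trans[OF _ r_ge]) (simp add: ge_one_powr_ge_zero)
  have "inv_sq s h powr (1 / (2 * lam)) = (1 / ?r) powr (1 / lam)"
    using lam unfolding inv_sq_eq_powr powr_powr by simp
  then have "?r powr (- 1 / lam) = inv_sq s h powr (1 / (2 * lam))"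
    using r1 by (simp add: powr_divide powr_minus_divide)
  also have "\<dots> \<le> R_crit \<alpha> \<gamma> s N z powr (1 / (2 * lam))"
    using lam inverse_r_weight_sq_le_R_crit[OF lattice_weights_axioms hd h0] by (intro powr_mono2) auto
  also have "\<dots> \<le> (G s - 1) / ((1 - \<tau>) * (real N - 1))"
    using tau z by (intro R_crit_cbc_le) auto
  \<comment> \<open>N - 1 \<ge> M / 2 in the pool, whence the factor 2 / M in
    \<open>Q\<close>.\<close>
  also have "\<dots> \<le> (G s - 1) / ((1 - \<tau>) * (real M / 2))"
    using prime_pool_gt[OF NP] tau M G_ge_1[of s] by (intro divide_left_mono mult_left_mono mult_pos_pos) auto
  also have "\<dots> = Q" unfolding Gs by simp
  finally have rQ: "?r powr (- 1 / lam) \<le> Q" .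
  \<comment> \<open>This solves 2 - e / lam = \<delta> / \<alpha>: of the two powers of r all but
    \<delta> / \<alpha> are traded for powers of \<open>Q\<close>.\<close>
  define e where "e = 2 * lam * (1 - \<delta> / (2 * \<alpha>))"
  have e0: "0 \<le> e" unfolding e_def using lam alpha \<delta> by (intro mult_nonneg_nonneg) (auto simp: field_simps)
  define X where "X = ?r powr (\<delta> / \<alpha>)"
  have "X = ?r powr (- 1 / lam * e + 2)"
    unfolding X_def e_def using lam alpha by (intro arg_cong2[where f="(powr)"]) (auto simp: field_simps)
  also have "\<dots> = (?r powr (- 1 / lam)) powr e * ?r\<^sup>2"
    unfolding powr_add powr_powr using r1 by simp
  also have "\<dots> \<le> Q powr e * ?r\<^sup>2"
    using rQ e0 by (intro mult_right_mono powr_mono2) auto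
  finally have X: "X \<le> Q powr e * ?r\<^sup>2" .
  have X1: "1 \<le> X" unfolding X_def using r1 \<delta> alpha by (intro ge_one_powr_ge_zero) auto
  have "\<alpha> * ln \<bar>real_of_int (h i)\<bar> = ln (\<bar>real_of_int (h i)\<bar> powr \<alpha>)"
    using hi1 by (simp add: ln_powr)
  also have "\<dots> \<le> ln ?r" using r_ge hi1 by (intro ln_mono) auto
  finally have ln1: "\<alpha> * ln \<bar>real_of_int (h i)\<bar> \<le> ln ?r" .
  \<comment> \<open>ln X \<le> X turns the logarithm into a power of r at the cost of 1 / \<delta>.
    The factors \<alpha> cancel because r is at least |h i|^\<alpha>, so the constant stays
    absolute.\<close>
  have "\<delta> / \<alpha> * ln ?r = ln X" unfolding X_def using r1 by (simp add: ln_powr)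
  also have "\<dots> \<le> X" using ln_le_minus_one[of X] X1 by linarith
  finally have "\<delta> * ln ?r \<le> \<alpha> * X" using alpha by (simp add: field_simps)
  moreover have "\<delta> * (\<alpha> * ln \<bar>real_of_int (h i)\<bar>) \<le> \<delta> * ln ?r" using ln1 \<delta> by (intro mult_left_mono) auto
  ultimately have "\<alpha> * (\<delta> * ln \<bar>real_of_int (h i)\<bar>) \<le> \<alpha> * X" by (simp add: mult_ac)
  then have ln2: "ln \<bar>real_of_int (h i)\<bar> \<le> X / \<delta>" using alpha \<delta> by (simp add: field_simps)
  have "dual_prob s \<alpha> \<gamma> M \<tau> h \<le> 2 / (\<tau> * real M) + 2 * ln \<bar>real_of_int (h i)\<bar> / (c * real M)"
    using tau s M c h(3,4) by (rule dual_prob_le)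
  also have "\<dots> \<le> 2 / (\<delta> * \<tau> * real M) * X + (2 / c) / (\<delta> * \<tau> * real M) * X"
  proof (rule add_mono)
    have "2 / (\<tau> * real M) \<le> 2 / (\<delta> * \<tau> * real M)"
      using \<delta> tau M by (intro divide_left_mono) (auto simp: mult_le_cancel_right1)
    also have "\<dots> \<le> 2 / (\<delta> * \<tau> * real M) * X"
      using mult_left_mono[OF X1, of "2 / (\<delta> * \<tau> * real M)"] \<delta> tau by simp
    finally show "2 / (\<tau> * real M) \<le> 2 / (\<delta> * \<tau> * real M) * X" .
    have "2 * ln \<bar>real_of_int (h i)\<bar> / (c * real M) \<le> 2 * (X / \<delta>) / (c * real M)"
      using ln2 c by (intro divide_right_mono) auto
    also have "\<dots> = (2 / c) / (\<delta> * real M) * X" by (simp add: field_simps)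
    also have "\<dots> \<le> (2 / c) / (\<delta> * \<tau> * real M) * X"
      using X1 c \<delta> tau M by (intro mult_right_mono divide_left_mono) (auto simp: mult_le_cancel_right2)
    finally show "2 * ln \<bar>real_of_int (h i)\<bar> / (c * real M) \<le> (2 / c) / (\<delta> * \<tau> * real M) * X" .
  qed
  also have "\<dots> = (2 + 2 / c) / (\<delta> * \<tau> * real M) * X"
    by (simp add: add_divide_distrib algebra_simps)
  also have "\<dots> \<le> (2 + 2 / c) / (\<delta> * \<tau> * real M) * (Q powr e * ?r\<^sup>2)"
    using X c \<delta> tau by (intro mult_left_mono) auto
  finally show ?thesis by (simp add: e_def mult.assoc)
qed

section \<open>Randomly shifted and tent-transformed lattice rules\<close>

text \<open>Write 2 cos t as a sum of two conjugate exponentials and multiply out: each choice of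
  signs gives one exponential, and real parts are taken.\<close>

lemma prod_cos_eq_avg:
  fixes \<theta> :: "nat \<Rightarrow> real"
  assumes "finite I"
  shows "(\<Prod>j\<in>I. cos (\<theta> j)) = (\<Sum>e\<in>I \<rightarrow>\<^sub>E {-1, 1::int}. cos (\<Sum>j\<in>I. real_of_int (e j) * \<theta> j)) / 2 ^ card I"
proof -
  have cis_sum: "(\<Prod>j\<in>I. cis (t j)) = cis (\<Sum>j\<in>I. t j)" for t :: "nat \<Rightarrow> real"
    using assms by (induction I rule: finite_induct) (auto simp: cis_mult)
  have "complex_of_real (\<Prod>j\<in>I. 2 * cos (\<theta> j)) = (\<Prod>j\<in>I. \<Sum>e\<in>{-1, 1::int}. cis (real_of_int e * \<theta> j))"
    unfolding of_real_prod by (intro prod.cong refl) (simp add: complex_eq_iff)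
  also have "\<dots> = (\<Sum>e\<in>I \<rightarrow>\<^sub>E {-1, 1::int}. \<Prod>j\<in>I. cis (real_of_int (e j) * \<theta> j))"
    using assms by (intro prod_sum_PiE) auto
  also have "\<dots> = (\<Sum>e\<in>I \<rightarrow>\<^sub>E {-1, 1::int}. cis (\<Sum>j\<in>I. real_of_int (e j) * \<theta> j))"
    by (simp only: cis_sum)
  finally have "(\<Prod>j\<in>I. 2 * cos (\<theta> j)) = Re (\<Sum>e\<in>I \<rightarrow>\<^sub>E {-1, 1::int}. cis (\<Sum>j\<in>I. real_of_int (e j) * \<theta> j))"
    by (metis Re_complex_of_real)
  then show ?thesis by (simp add: prod.distrib field_simps)
qed

text \<open>The double sum is the squared modulus of a geometric sum over an N-th root of unity,
  which is \<open>N\<close> or 0.\<close>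

lemma sum_cos_diff_eq:
  assumes N: "0 < N"
  shows "(\<Sum>n<N. \<Sum>m<N. cos (2 * pi * (real n - real m) * real_of_int H / real N)) =
    (if int N dvd H then (real N)\<^sup>2 else 0)"
proof -
  define t where "t = 2 * pi * real_of_int H / real N"
  have "(\<Sum>n<N. \<Sum>m<N. cos (2 * pi * (real n - real m) * real_of_int H / real N)) =
      (\<Sum>n<N. \<Sum>m<N. Re (cis (real n * t) * cnj (cis (real m * t))))"
    by (intro sum.cong refl) (simp add: cis_cnj cis_mult t_def, simp add: algebra_simps diff_divide_distrib)
  also have "\<dots> = Re ((\<Sum>n<N. cis (real n * t)) * cnj (\<Sum>m<N. cis (real m * t)))"
    by (simp only: sum_product cnj_sum Re_sum)
  also have "(\<Sum>n<N. cis (real n * t)) = (\<Sum>n<N. cis t ^ n)"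
    by (intro sum.cong refl) (rule Complex.DeMoivre[symmetric])
  also have "Re ((\<Sum>n<N. cis t ^ n) * cnj (\<Sum>n<N. cis t ^ n)) = (if int N dvd H then (real N)\<^sup>2 else 0)"
  proof (cases "int N dvd H")
    case True
    then obtain q where "H = int N * q" by (rule dvdE)
    then have "t = 2 * pi * real_of_int q" using N by (simp add: t_def)
    then have "cis t = 1" by simp
    then show ?thesis using True by (simp add: power2_eq_square)
  next
    case False
    have "cis t \<noteq> 1"
    proof
      assume "cis t = 1"
      then have "cos t = 1" by (simp add: complex_eq_iff)
      then obtain q :: int where "t = real_of_int q * 2 * pi" by (auto simp: cos_one_2pi_int)
      then have "real_of_int H = real_of_int q * real N" using N by (simp add: t_def field_simps)
      then have "H = q * int N" by (metis of_int_eq_iff of_int_mult of_int_of_nat_eq)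
      then show False using False by simp
    qed
    moreover have "cis t ^ N = 1"
    proof -
      have "real N * t = 2 * pi * real_of_int H" using N by (simp add: t_def)
      then show ?thesis by (simp add: Complex.DeMoivre)
    qed
    ultimately show ?thesis using False by (simp add: geometric_sum)
  qed
  finally show ?thesis .
qed

lemma set_integrable_continuous_half_open:
  fixes f :: "real \<Rightarrow> real"
  assumes "continuous_on UNIV f"
  shows "set_integrable lborel {0..<1} f"
  by (rule set_integrable_subset[OF borel_integrable_atLeastAtMost'[of 0 1]])
     (use assms in \<open>auto intro: continuous_on_subset\<close>)

lemma set_lebesgue_integral_cos:
  fixes m :: int
  shows "(LINT x:{0..<1}|lborel. cos (2 * pi * real_of_int m * x + c)) = (if m = 0 then cos c else 0)"
proof -
  let ?f = "\<lambda>x. cos (2 * pi * real_of_int m * x + c)"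
  have cont: "continuous_on A ?f" for A by (intro continuous_intros)
  have "(LINT x:{0..<1}|lborel. ?f x) = (LINT x:{0..1}|lborel. ?f x)"
    unfolding set_lebesgue_integral_def
    by (rule integral_discrete_difference[of "{1}"]) (auto simp: indicator_def)
  also have "\<dots> = integral {0..1} ?f"
    by (intro set_borel_integral_eq_integral borel_integrable_atLeastAtMost' cont)
  also have "\<dots> = (if m = 0 then cos c else 0)"
  proof (cases "m = 0")
    case False
    let ?F = "\<lambda>x. sin (2 * pi * real_of_int m * x + c) / (2 * pi * real_of_int m)"
    have "(?f has_integral (?F 1 - ?F 0)) {0..1}"
      using False
      by (intro fundamental_theorem_of_calculus)
         (auto intro!: derivative_eq_intros simp flip: has_real_derivative_iff_has_vector_derivative)
    moreover have "sin (2 * pi * real_of_int m * 1 + c) = sin c"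
      by (simp add: sin_add)
    ultimately show ?thesis using False by (simp add: integral_unique)
  qed simp
  finally show ?thesis .
qed

lemma cos_product_orthogonal:
  fixes k l :: nat
  shows "(LINT x:{0..<1}|lborel. (sqrt (2 - (if k = 0 then 1 else 0)) * cos (2 * pi * real k * (a + x))) *
      (sqrt (2 - (if l = 0 then 1 else 0)) * cos (2 * pi * real l * (b + x)))) =
    (if k = l then cos (2 * pi * real k * (a - b)) else 0)" (is "?L = _")
proof -
  let ?w = "\<lambda>k::nat. sqrt (2 - (if k = 0 then 1 else 0))"
  let ?c1 = "\<lambda>x. cos (2 * pi * real_of_int (int k - int l) * x + (2 * pi * real k * a - 2 * pi * real l * b))"
  let ?c2 = "\<lambda>x. cos (2 * pi * real_of_int (int k + int l) * x + (2 * pi * real k * a + 2 * pi * real l * b))"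
  have "?L = (LINT x:{0..<1}|lborel. ?w k * ?w l / 2 * ?c1 x + ?w k * ?w l / 2 * ?c2 x)"
  proof (intro set_lebesgue_integral_cong ballI allI impI)
    fix x :: real
    have "cos (2 * pi * real k * (a + x)) * cos (2 * pi * real l * (b + x)) =
        (cos (2 * pi * real k * (a + x) - 2 * pi * real l * (b + x)) + cos (2 * pi * real k * (a + x) + 2 * pi * real l * (b + x))) / 2"
      by (rule cos_times_cos)
    also have "2 * pi * real k * (a + x) - 2 * pi * real l * (b + x) =
        2 * pi * real_of_int (int k - int l) * x + (2 * pi * real k * a - 2 * pi * real l * b)"
      by (simp add: algebra_simps)
    also have "2 * pi * real k * (a + x) + 2 * pi * real l * (b + x) =
        2 * pi * real_of_int (int k + int l) * x + (2 * pi * real k * a + 2 * pi * real l * b)"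
      by (simp add: algebra_simps)
    finally have e: "cos (2 * pi * real k * (a + x)) * cos (2 * pi * real l * (b + x)) = (?c1 x + ?c2 x) / 2" .
    have "(?w k * cos (2 * pi * real k * (a + x))) * (?w l * cos (2 * pi * real l * (b + x))) =
      ?w k * ?w l * (cos (2 * pi * real k * (a + x)) * cos (2 * pi * real l * (b + x)))" by (simp only: mult_ac)
    also have "\<dots> = ?w k * ?w l / 2 * ?c1 x + ?w k * ?w l / 2 * ?c2 x"
      unfolding e by (simp add: distrib_left)
    finally show "(?w k * cos (2 * pi * real k * (a + x))) * (?w l * cos (2 * pi * real l * (b + x))) =
      ?w k * ?w l / 2 * ?c1 x + ?w k * ?w l / 2 * ?c2 x" .
  qed auto
  also have "\<dots> = (LINT x:{0..<1}|lborel. ?w k * ?w l / 2 * ?c1 x) + (LINT x:{0..<1}|lborel. ?w k * ?w l / 2 * ?c2 x)"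
    by (intro set_integral_add(2) set_integrable_continuous_half_open continuous_intros)
  also have "\<dots> = ?w k * ?w l / 2 * (LINT x:{0..<1}|lborel. ?c1 x) + ?w k * ?w l / 2 * (LINT x:{0..<1}|lborel. ?c2 x)"
    by (simp only: set_integral_mult_right)
  \<comment> \<open>For k = l > 0 only \<open>?c1\<close> survives, with weight 2 / 2; for k = l = 0
    both survive, with weight 1 / 2 each.\<close>
  also have "\<dots> = (if k = l then cos (2 * pi * real k * (a - b)) else 0)"
    unfolding set_lebesgue_integral_cos by (auto simp: algebra_simps)
  finally show ?thesis .
qed

section \<open>The cosine basis after the tent transformation\<close>

definition periodic_basis :: "nat \<Rightarrow> (nat \<Rightarrow> nat) \<Rightarrow> (nat \<Rightarrow> real) \<Rightarrow> real" where
  "periodic_basis s k x =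
     (\<Prod>j\<in>{1..s}. sqrt (2 - (if k j = 0 then 1 else 0)) * cos (2 * pi * real (k j) * x j))"

lemma cos_tent:
  assumes "0 \<le> x" "x \<le> 1"
  shows "cos (pi * real k * tent x) = cos (2 * pi * real k * x)"
proof (cases "x \<le> 1 / 2")
  case True
  then have "tent x = 2 * x" by (simp add: tent_def)
  then show ?thesis by (simp add: mult_ac)
next
  case False
  then have t: "tent x = 2 - 2 * x" by (simp add: tent_def)
  have "pi * real k * tent x = 2 * pi * real_of_int (int k) + - (2 * pi * real k * x)"
    unfolding t by (simp add: algebra_simps)
  then show ?thesis
    using cos_int_2pin[of "int k"] sin_int_2pin[of "int k"] by (simp add: cos_diff)
qed

lemma cos_mult_frac: "cos (2 * pi * real k * frac y) = cos (2 * pi * real k * y)"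
proof -
  have "2 * pi * real k * frac y = 2 * pi * real k * y - 2 * pi * real_of_int (int k * \<lfloor>y\<rfloor>)"
    by (simp add: frac_def algebra_simps)
  then show ?thesis by (simp only: cos_diff cos_int_2pin sin_int_2pin mult_1_right mult_zero_right add_0_right)
qed

lemma cos_basis_tent_vec_frac:
  "cos_basis s k (tent_vec s (\<lambda>j\<in>{1..s}. frac (y j))) = periodic_basis s k y"
  unfolding cos_basis_def periodic_basis_def
proof (intro prod.cong refl arg_cong2[where f = "(*)"])
  fix j assume "j \<in> {1..s}"
  then show "cos (pi * real (k j) * tent_vec s (\<lambda>j\<in>{1..s}. frac (y j)) j) = cos (2 * pi * real (k j) * y j)"
    using cos_tent[of "frac (y j)" "k j"] cos_mult_frac[of "k j" "y j"]
    by (simp add: tent_vec_def frac_ge_0 less_imp_le[OF frac_lt_1])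
qed

lemma tent_vec_frac_in_cube: "tent_vec s (\<lambda>j\<in>{1..s}. frac (y j)) \<in> cube s"
proof -
  have "tent (frac t) \<in> {0..1}" for t :: real
    using frac_ge_0[of t] frac_lt_1[of t] by (auto simp: tent_def abs_if)
  then show ?thesis by (auto simp: tent_vec_def cube_def)
qed

lemma abs_periodic_basis_le: "\<bar>periodic_basis s k x\<bar> \<le> cos_basis s k (\<lambda>j\<in>{1..s}. 0)"
proof -
  have "\<bar>periodic_basis s k x\<bar> \<le> (\<Prod>j\<in>{1..s}. sqrt (2 - (if k j = 0 then 1 else 0)) * 1)"
    unfolding periodic_basis_def abs_prod abs_mult
    by (intro prod_mono conjI mult_mono abs_cos_le_one) auto
  then show ?thesis by (simp add: cos_basis_def)
qed

text \<open>The indicator of the cube factors into indicators of intervals on extensional vectors,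
  hence the argument on the space of the product measure: there a vector outside the cube has a
  coordinate outside [0, 1).\<close>

lemma lborel_dim_integral_prod:
  fixes f :: "nat \<Rightarrow> real \<Rightarrow> real"
  assumes "\<And>j. j \<in> {1..s} \<Longrightarrow> set_integrable lborel {0..<1} (f j)"
  shows "set_integrable (lborel_dim s) (half_open_cube s) (\<lambda>x. \<Prod>j\<in>{1..s}. f j (x j))" (is ?A)
    and "(LINT x:half_open_cube s|lborel_dim s. \<Prod>j\<in>{1..s}. f j (x j)) = (\<Prod>j\<in>{1..s}. LINT x:{0..<1}|lborel. f j x)" (is ?B)
proof -
  interpret product_sigma_finite "\<lambda>_::nat. lborel :: real measure" by standard
  have eq: "indicator (half_open_cube s) x *\<^sub>R (\<Prod>j\<in>{1..s}. f j (x j)) = (\<Prod>j\<in>{1..s}. indicator {0..<1} (x j) *\<^sub>R f j (x j))"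
    if "x \<in> space (lborel_dim s)" for x
  proof (cases "x \<in> half_open_cube s")
    case True
    then have "x j \<in> {0..<1}" if "j \<in> {1..s}" for j
      using PiE_mem[of x "{1..s}" "\<lambda>_. {0..<1}" j] that by (simp add: half_open_cube_def)
    then have "(\<Prod>j\<in>{1..s}. indicator {0..<1} (x j) *\<^sub>R f j (x j)) = (\<Prod>j\<in>{1..s}. f j (x j))"
      by (intro prod.cong refl) simp
    then show ?thesis using True by simp
  next
    case False
    have "x \<in> extensional {1..s}" using that by (simp add: space_PiM PiE_def)
    then have "\<exists>j\<in>{1..s}. x j \<notin> {0..<1}"
      using False unfolding half_open_cube_def PiE_def Pi_def by blast
    then obtain j where "j \<in> {1..s}" "x j \<notin> {0..<1}" by blast
    then have "(\<Prod>j\<in>{1..s}. indicator {0..<1} (x j) *\<^sub>R f j (x j)) = 0"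
      by (intro prod_zero) (auto intro!: bexI[of _ j])
    then show ?thesis using False by simp
  qed
  have int: "integrable lborel (\<lambda>x. indicator {0..<1} x *\<^sub>R f j x)" if "j \<in> {1..s}" for j
    using assms[OF that] by (simp only: set_integrable_def)
  have "integrable (lborel_dim s) (\<lambda>x. \<Prod>j\<in>{1..s}. indicator {0..<1} (x j) *\<^sub>R f j (x j))"
    by (rule product_integrable_prod[OF finite_atLeastAtMost int])
  then show ?A
    unfolding set_integrable_def by (subst Bochner_Integration.integrable_cong[OF refl eq])
  have "(\<integral>x. (\<Prod>j\<in>{1..s}. indicator {0..<1} (x j) *\<^sub>R f j (x j)) \<partial>lborel_dim s) =
      (\<Prod>j\<in>{1..s}. \<integral>x. indicator {0..<1} x *\<^sub>R f j x \<partial>lborel)"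
    by (rule product_integral_prod[OF finite_atLeastAtMost int])
  then show ?B
    unfolding set_lebesgue_integral_def by (subst Bochner_Integration.integral_cong[OF refl eq])
qed

text \<open>The two offsets serve the square of a lattice average, which multiplies values at
  different nodes.\<close>

lemma periodic_basis_orthogonal:
  assumes k: "k \<in> cos_freqs s" and l: "l \<in> cos_freqs s"
  shows "set_integrable (lborel_dim s) (half_open_cube s)
      (\<lambda>x. periodic_basis s k (\<lambda>j. a j + x j) * periodic_basis s l (\<lambda>j. b j + x j))" (is ?A)
    and "(LINT x:half_open_cube s|lborel_dim s.
        periodic_basis s k (\<lambda>j. a j + x j) * periodic_basis s l (\<lambda>j. b j + x j)) =
      (if k = l then \<Prod>j\<in>{1..s}. cos (2 * pi * real (k j) * (a j - b j)) else 0)" (is ?B)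
proof -
  let ?g = "\<lambda>j x. (sqrt (2 - (if k j = 0 then 1 else 0)) * cos (2 * pi * real (k j) * (a j + x))) *
      (sqrt (2 - (if l j = 0 then 1 else 0)) * cos (2 * pi * real (l j) * (b j + x)))"
  have eq: "(\<lambda>x. periodic_basis s k (\<lambda>j. a j + x j) * periodic_basis s l (\<lambda>j. b j + x j)) = (\<lambda>x. \<Prod>j\<in>{1..s}. ?g j (x j))"
    by (simp only: periodic_basis_def prod.distrib)
  have int: "set_integrable lborel {0..<1} (?g j)" for j
    by (intro set_integrable_continuous_half_open continuous_intros)
  show ?A unfolding eq by (intro lborel_dim_integral_prod int)
  have "(LINT x:half_open_cube s|lborel_dim s. \<Prod>j\<in>{1..s}. ?g j (x j)) = (\<Prod>j\<in>{1..s}. LINT x:{0..<1}|lborel. ?g j x)"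
    by (intro lborel_dim_integral_prod int)
  also have "\<dots> = (\<Prod>j\<in>{1..s}. if k j = l j then cos (2 * pi * real (k j) * (a j - b j)) else 0)"
    by (simp only: cos_product_orthogonal)
  also have "\<dots> = (if k = l then \<Prod>j\<in>{1..s}. cos (2 * pi * real (k j) * (a j - b j)) else 0)"
  proof (cases "k = l")
    case False
    then obtain j where "k j \<noteq> l j" by blast
    moreover from this have "j \<in> {1..s}"
      using k l by (cases "j \<in> {1..s}") (auto simp: cos_freqs_def PiE_def extensional_def)
    ultimately have "(\<Prod>j\<in>{1..s}. if k j = l j then cos (2 * pi * real (k j) * (a j - b j)) else 0) = 0"
      by (intro prod_zero) (auto intro!: bexI[of _ j])
    then show ?thesis using False by simp
  qed simp
  finally show ?B unfolding eq .
qed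

lemma set_integral_finite_sum:
  fixes f :: "'i \<Rightarrow> 'a \<Rightarrow> real"
  assumes "\<And>i. i \<in> I \<Longrightarrow> set_integrable M A (f i)"
  shows "set_integrable M A (\<lambda>x. \<Sum>i\<in>I. f i x)"
    and "(LINT x:A|M. \<Sum>i\<in>I. f i x) = (\<Sum>i\<in>I. LINT x:A|M. f i x)"
  using assms unfolding set_integrable_def set_lebesgue_integral_def
  by (simp_all only: scaleR_sum_right) (auto intro!: Bochner_Integration.integrable_sum Bochner_Integration.integral_sum)

section \<open>Lattice averages as orthogonal functions of the shift\<close>

definition lattice_basis :: "nat \<Rightarrow> nat \<Rightarrow> (nat \<Rightarrow> nat) \<Rightarrow> (nat \<Rightarrow> nat) \<Rightarrow> (nat \<Rightarrow> real) \<Rightarrow> real" where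
  "lattice_basis s N z k \<Delta> =
     (\<Sum>n<N. periodic_basis s k (\<lambda>j. real n * real (z j) / real N + \<Delta> j)) / real N"

text \<open>The mean square of \<open>lattice_basis\<close> over the shift; the signs come from expanding a product of
  cosines.\<close>

definition signed_dual_fraction :: "nat \<Rightarrow> nat \<Rightarrow> (nat \<Rightarrow> nat) \<Rightarrow> (nat \<Rightarrow> nat) \<Rightarrow> real" where
  "signed_dual_fraction s N z k = (\<Sum>e\<in>{1..s} \<rightarrow>\<^sub>E {-1, 1::int}.
     if int N dvd (\<Sum>j\<in>{1..s}. e j * int (k j) * int (z j)) then 1 else 0) / 2 ^ s"

lemma sum_prod_cos_eq_signed_dual_fraction:
  assumes N: "0 < N"
  shows "(\<Sum>n<N. \<Sum>m<N. \<Prod>j\<in>{1..s}. cos (2 * pi * real (k j) * (real n * real (z j) / real N - real m * real (z j) / real N)))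
    = signed_dual_fraction s N z k * (real N)\<^sup>2"
proof -
  let ?E = "{1..s} \<rightarrow>\<^sub>E {-1, 1::int}"
  let ?H = "\<lambda>e. \<Sum>j\<in>{1..s}. e j * int (k j) * int (z j)"
  have "(\<Sum>n<N. \<Sum>m<N. \<Prod>j\<in>{1..s}. cos (2 * pi * real (k j) * (real n * real (z j) / real N - real m * real (z j) / real N)))
      = (\<Sum>n<N. \<Sum>m<N. (\<Sum>e\<in>?E. cos (2 * pi * (real n - real m) * real_of_int (?H e) / real N)) / 2 ^ s)"
  proof (intro sum.cong refl)
    fix n m
    have "(\<Sum>j\<in>{1..s}. real_of_int (e j) * (2 * pi * real (k j) * (real n * real (z j) / real N - real m * real (z j) / real N)))
      = 2 * pi * (real n - real m) * real_of_int (?H e) / real N" for e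
      unfolding of_int_sum sum_distrib_left sum_divide_distrib
      by (intro sum.cong refl) (simp add: diff_divide_distrib[symmetric] left_diff_distrib[symmetric])
    then show "(\<Prod>j\<in>{1..s}. cos (2 * pi * real (k j) * (real n * real (z j) / real N - real m * real (z j) / real N)))
      = (\<Sum>e\<in>?E. cos (2 * pi * (real n - real m) * real_of_int (?H e) / real N)) / 2 ^ s"
      by (subst prod_cos_eq_avg) simp_all
  qed
  also have "\<dots> = (\<Sum>n<N. \<Sum>e\<in>?E. \<Sum>m<N. cos (2 * pi * (real n - real m) * real_of_int (?H e) / real N)) / 2 ^ s"
    unfolding sum_divide_distrib[symmetric] by (intro arg_cong2[where f = "(/)"] sum.cong refl sum.swap)
  also have "\<dots> = (\<Sum>e\<in>?E. \<Sum>n<N. \<Sum>m<N. cos (2 * pi * (real n - real m) * real_of_int (?H e) / real N)) / 2 ^ s"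
    by (intro arg_cong2[where f = "(/)"] refl sum.swap)
  also have "\<dots> = (\<Sum>e\<in>?E. if int N dvd ?H e then (real N)\<^sup>2 else 0) / 2 ^ s"
    by (simp only: sum_cos_diff_eq[OF N])
  also have "\<dots> = signed_dual_fraction s N z k * (real N)\<^sup>2"
    unfolding signed_dual_fraction_def times_divide_eq_left sum_distrib_right
    by (intro arg_cong2[where f = "(/)"] sum.cong refl) simp
  finally show ?thesis .
qed

text \<open>For distinct frequencies every pair of nodes integrates to 0. For k = l the remaining
  cosines, summed over both nodes, give N^2 times the fraction of sign patterns in the dual
  lattice.\<close>

lemma lattice_basis_orthogonal:
  assumes N: "0 < N" and k: "k \<in> cos_freqs s" and l: "l \<in> cos_freqs s"
  shows "set_integrable (lborel_dim s) (half_open_cube s) (\<lambda>\<Delta>. lattice_basis s N z k \<Delta> * lattice_basis s N z l \<Delta>)" (is ?A)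
    and "(LINT \<Delta>:half_open_cube s|lborel_dim s. lattice_basis s N z k \<Delta> * lattice_basis s N z l \<Delta>) =
      (if k = l then signed_dual_fraction s N z k else 0)" (is ?B)
proof -
  let ?y = "\<lambda>n j. real n * real (z j) / real N"
  let ?u = "\<lambda>n m \<Delta>. periodic_basis s k (\<lambda>j. ?y n j + \<Delta> j) * periodic_basis s l (\<lambda>j. ?y m j + \<Delta> j)"
  have eq: "(\<lambda>\<Delta>. lattice_basis s N z k \<Delta> * lattice_basis s N z l \<Delta>) = (\<lambda>\<Delta>. (\<Sum>n<N. \<Sum>m<N. ?u n m \<Delta>) / (real N)\<^sup>2)"
    by (simp add: lattice_basis_def sum_product power2_eq_square)
  note u = periodic_basis_orthogonal[OF k l, of "?y n" "?y m" for n m]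
  show ?A unfolding eq by (intro set_integrable_divide set_integral_finite_sum(1) u(1))
  have "(LINT \<Delta>:half_open_cube s|lborel_dim s. (\<Sum>n<N. \<Sum>m<N. ?u n m \<Delta>) / (real N)\<^sup>2) =
      (\<Sum>n<N. \<Sum>m<N. LINT \<Delta>:half_open_cube s|lborel_dim s. ?u n m \<Delta>) / (real N)\<^sup>2"
    by (simp only: set_integral_divide_zero set_integral_finite_sum u(1))
  also have "\<dots> = (if k = l then signed_dual_fraction s N z k else 0)"
  proof (cases "k = l")
    case True
    show ?thesis
      unfolding u(2) if_P[OF True] sum_prod_cos_eq_signed_dual_fraction[OF N] using N by simp
  next
    case False
    show ?thesis unfolding u(2) if_not_P[OF False] by simp
  qed
  finally show ?B unfolding eq .
qed

lemma lattice_basis_sum_square: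
  fixes a :: "(nat \<Rightarrow> nat) \<Rightarrow> real"
  assumes N: "0 < N" and F: "finite F" "F \<subseteq> cos_freqs s"
  shows "set_integrable (lborel_dim s) (half_open_cube s) (\<lambda>\<Delta>. (\<Sum>k\<in>F. a k * lattice_basis s N z k \<Delta>)\<^sup>2)" (is ?A)
    and "(LINT \<Delta>:half_open_cube s|lborel_dim s. (\<Sum>k\<in>F. a k * lattice_basis s N z k \<Delta>)\<^sup>2) =
      (\<Sum>k\<in>F. (a k)\<^sup>2 * signed_dual_fraction s N z k)" (is ?B)
proof -
  let ?u = "\<lambda>k l \<Delta>. (a k * a l) * (lattice_basis s N z k \<Delta> * lattice_basis s N z l \<Delta>)"
  have eq: "(\<lambda>\<Delta>. (\<Sum>k\<in>F. a k * lattice_basis s N z k \<Delta>)\<^sup>2) = (\<lambda>\<Delta>. \<Sum>k\<in>F. \<Sum>l\<in>F. ?u k l \<Delta>)"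
    unfolding power2_eq_square sum_product by (intro ext sum.cong refl) (simp only: mult_ac)
  have int: "set_integrable (lborel_dim s) (half_open_cube s) (?u k l)" if "k \<in> F" "l \<in> F" for k l
    using that F by (intro set_integrable_mult_right lattice_basis_orthogonal(1) N) auto
  show ?A unfolding eq by (intro set_integral_finite_sum(1) int)
  have "(LINT \<Delta>:half_open_cube s|lborel_dim s. \<Sum>k\<in>F. \<Sum>l\<in>F. ?u k l \<Delta>) =
      (\<Sum>k\<in>F. LINT \<Delta>:half_open_cube s|lborel_dim s. \<Sum>l\<in>F. ?u k l \<Delta>)"
    by (intro set_integral_finite_sum int)
  also have "\<dots> = (\<Sum>k\<in>F. \<Sum>l\<in>F. LINT \<Delta>:half_open_cube s|lborel_dim s. ?u k l \<Delta>)"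
    by (intro sum.cong refl set_integral_finite_sum int)
  also have "\<dots> = (\<Sum>k\<in>F. \<Sum>l\<in>F. if k = l then (a k)\<^sup>2 * signed_dual_fraction s N z k else 0)"
  proof (intro sum.cong refl)
    fix k l assume "k \<in> F" "l \<in> F"
    then have kl: "k \<in> cos_freqs s" "l \<in> cos_freqs s" using F by auto
    then show "(LINT \<Delta>:half_open_cube s|lborel_dim s. ?u k l \<Delta>) = (if k = l then (a k)\<^sup>2 * signed_dual_fraction s N z k else 0)"
      unfolding set_integral_mult_right lattice_basis_orthogonal(2)[OF N kl] by (simp add: power2_eq_square)
  qed
  also have "\<dots> = (\<Sum>k\<in>F. (a k)\<^sup>2 * signed_dual_fraction s N z k)"
    using F by (intro sum.cong refl) simp
  finally show ?B unfolding eq .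
qed

lemma qmc_shifted_lattice:
  "qmc g (shifted_lattice s N z \<Delta>) =
    (\<Sum>n<N. g (\<lambda>j\<in>{1..s}. frac (real n * real (z j) / real N + \<Delta> j))) / real N"
  unfolding qmc_def shifted_lattice_def
  by (simp add: image_mset.compositionality o_def sum_unfold_sum_mset lessThan_atLeast0)

lemma abs_lattice_basis_le: "\<bar>lattice_basis s N z k \<Delta>\<bar> \<le> cos_basis s k (\<lambda>j\<in>{1..s}. 0)"
proof (cases "N = 0")
  case True
  then show ?thesis by (auto simp: lattice_basis_def cos_basis_def intro!: prod_nonneg)
next
  case False
  have "\<bar>\<Sum>n<N. periodic_basis s k (\<lambda>j. real n * real (z j) / real N + \<Delta> j)\<bar> \<le> (\<Sum>n<N. cos_basis s k (\<lambda>j\<in>{1..s}. 0))"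
    by (intro order_trans[OF sum_abs] sum_mono abs_periodic_basis_le)
  then show ?thesis using False by (simp add: lattice_basis_def field_simps)
qed

lemma zero_freq:
  "(\<lambda>j\<in>{1..s}. 0) \<in> cos_freqs s"
  "cos_coefficient s f (\<lambda>j\<in>{1..s}. 0) = cube_integral s f"
  "0 < N \<Longrightarrow> lattice_basis s N z (\<lambda>j\<in>{1..s}. 0) \<Delta> = 1"
  "periodic_basis s (\<lambda>j\<in>{1..s}. 0) x = 1"
  by (simp_all add: cos_freqs_def cos_coefficient_def cos_basis_def lattice_basis_def periodic_basis_def)

section \<open>Truncation of the cosine series\<close>

text \<open>Modulus of the \<open>k\<close>-th term of the series at the origin, where every basis
  function attains its maximum. Absolute convergence at this one point thus yields a uniform
  majorant.\<close>

definition cos_bound :: "nat \<Rightarrow> ((nat \<Rightarrow> real) \<Rightarrow> real) \<Rightarrow> (nat \<Rightarrow> nat) \<Rightarrow> real" where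
  "cos_bound s f k = \<bar>cos_coefficient s f k\<bar> * cos_basis s k (\<lambda>j\<in>{1..s}. 0)"

lemma cos_basis_zero_nonneg: "0 \<le> cos_basis s k (\<lambda>j\<in>{1..s}. 0)"
  by (auto simp: cos_basis_def intro!: prod_nonneg)

lemma cos_bound_summable:
  assumes "f \<in> cos_space s \<alpha> \<gamma>"
  shows "cos_bound s f summable_on cos_freqs s"
proof -
  have "(\<lambda>j\<in>{1..s}. 0) \<in> cube s" by (auto simp: cube_def)
  then have "(\<lambda>k. \<bar>cos_coefficient s f k * cos_basis s k (\<lambda>j\<in>{1..s}. 0)\<bar>) summable_on cos_freqs s"
    using assms by (simp add: cos_space_def)
  then show ?thesis
    unfolding cos_bound_def using cos_basis_zero_nonneg by (simp add: abs_mult)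
qed

lemma cos_space_tail:
  assumes f: "f \<in> cos_space s \<alpha> \<gamma>" and F: "finite F" "F \<subseteq> cos_freqs s"
    and tail: "infsum (cos_bound s f) (cos_freqs s) - sum (cos_bound s f) F \<le> \<epsilon>"
  shows "\<bar>f (tent_vec s (\<lambda>j\<in>{1..s}. frac (y j))) - (\<Sum>k\<in>F. cos_coefficient s f k * periodic_basis s k y)\<bar> \<le> \<epsilon>"
proof -
  let ?x = "tent_vec s (\<lambda>j\<in>{1..s}. frac (y j))"
  let ?u = "\<lambda>k. cos_coefficient s f k * periodic_basis s k y"
  have "((\<lambda>k. cos_coefficient s f k * cos_basis s k ?x) has_sum f ?x) (cos_freqs s)"
    using f tent_vec_frac_in_cube[of s y] by (simp add: cos_space_def)
  then have u: "(?u has_sum f ?x) (cos_freqs s)" by (simp only: cos_basis_tent_vec_frac)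
  have le: "norm (?u k) \<le> cos_bound s f k" for k
    unfolding cos_bound_def real_norm_def abs_mult by (intro mult_left_mono abs_periodic_basis_le) auto
  have split: "cos_freqs s = F \<union> (cos_freqs s - F)" using F by auto
  have b: "cos_bound s f summable_on (cos_freqs s - F)"
    using cos_bound_summable[OF f] by (rule summable_on_subset_banach) auto
  have us: "(\<lambda>k. norm (?u k)) summable_on (cos_freqs s - F)"
    using b by (rule summable_on_comparison_test) (use le in auto)
  have "f ?x = infsum ?u (F \<union> (cos_freqs s - F))"
    unfolding split[symmetric] using u by (simp only: infsumI)
  also have "\<dots> = infsum ?u F + infsum ?u (cos_freqs s - F)"
    by (rule infsum_Un_disjoint) (use F abs_summable_summable[OF us] in auto)
  finally have "\<bar>f ?x - sum ?u F\<bar> = norm (infsum ?u (cos_freqs s - F))" using F by simp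
  also have "\<dots> \<le> (\<Sum>\<^sub>\<infinity>k\<in>cos_freqs s - F. norm (?u k))" by (rule norm_infsum_bound[OF us])
  also have "\<dots> \<le> infsum (cos_bound s f) (cos_freqs s - F)"
    by (intro infsum_mono us b le)
  also have "\<dots> = infsum (cos_bound s f) (cos_freqs s) - sum (cos_bound s f) F"
  proof -
    have "infsum (cos_bound s f) (F \<union> (cos_freqs s - F)) = infsum (cos_bound s f) F + infsum (cos_bound s f) (cos_freqs s - F)"
      using F b by (intro infsum_Un_disjoint) auto
    then show ?thesis using F split by simp
  qed
  finally show ?thesis using tail by simp
qed

lemma exists_small_tail:
  assumes f: "f \<in> cos_space s \<alpha> \<gamma>" and \<epsilon>: "0 < \<epsilon>"
  obtains F where "finite F" "F \<subseteq> cos_freqs s" "(\<lambda>j\<in>{1..s}. 0) \<in> F"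
    "infsum (cos_bound s f) (cos_freqs s) - sum (cos_bound s f) F \<le> \<epsilon>"
proof -
  obtain F where F: "finite F" "F \<subseteq> cos_freqs s"
      "dist (sum (cos_bound s f) F) (infsum (cos_bound s f) (cos_freqs s)) \<le> \<epsilon>"
    using infsum_finite_approximation[OF cos_bound_summable[OF f] \<epsilon>] by blast
  \<comment> \<open>The zero frequency is added because its term is the integral that the error
    subtracts; enlarging \<open>F\<close> only shrinks the tail.\<close>
  have "sum (cos_bound s f) F \<le> sum (cos_bound s f) (insert (\<lambda>j\<in>{1..s}. 0) F)"
    using F cos_basis_zero_nonneg by (intro sum_mono2) (auto simp: cos_bound_def)
  then have "infsum (cos_bound s f) (cos_freqs s) - sum (cos_bound s f) (insert (\<lambda>j\<in>{1..s}. 0) F) \<le> \<epsilon>"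
    using F(3) by (simp add: dist_real_def)
  then show thesis using F zero_freq(1)[of s] by (intro that[of "insert (\<lambda>j\<in>{1..s}. 0) F"]) auto
qed

text \<open>The series is truncated so that only finite sums are integrated term by term: the error
  is within \<epsilon> of \<open>?S\<close>, uniformly in the shift, and \<open>?S\<close> is
  bounded by the sum of \<open>cos_bound\<close>, which controls the cross term of the
  square.\<close>

lemma shift_mean_square_le:
  assumes f: "f \<in> cos_space s \<alpha> \<gamma>" and N: "0 < N" and F: "finite F" "F \<subseteq> cos_freqs s" "(\<lambda>j\<in>{1..s}. 0) \<in> F"
    and \<epsilon>: "0 < \<epsilon>" and tail: "infsum (cos_bound s f) (cos_freqs s) - sum (cos_bound s f) F \<le> \<epsilon>"
  shows "(LINT \<Delta>:half_open_cube s|lborel_dim s.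
      \<bar>qmc (f \<circ> tent_vec s) (shifted_lattice s N z \<Delta>) - cube_integral s f\<bar>\<^sup>2) \<le>
    (\<Sum>k\<in>F - {\<lambda>j\<in>{1..s}. 0}. (cos_coefficient s f k)\<^sup>2 * signed_dual_fraction s N z k)
      + (2 * infsum (cos_bound s f) (cos_freqs s) * \<epsilon> + \<epsilon>\<^sup>2)"
    (is "?L \<le> ?V + ?\<eta>")
proof -
  let ?o = "\<lambda>j\<in>{1..s}. 0 :: nat"
  let ?S = "\<lambda>\<Delta>. \<Sum>k\<in>F - {?o}. cos_coefficient s f k * lattice_basis s N z k \<Delta>"
  let ?A = "infsum (cos_bound s f) (cos_freqs s)"
  let ?g = "\<lambda>\<Delta>. qmc (f \<circ> tent_vec s) (shifted_lattice s N z \<Delta>) - cube_integral s f"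
  have bnn: "0 \<le> cos_bound s f k" for k using cos_basis_zero_nonneg by (simp add: cos_bound_def)
  have A0: "0 \<le> ?A" using bnn by (intro infsum_nonneg)
  have S: "\<bar>?S \<Delta>\<bar> \<le> ?A" for \<Delta>
  proof -
    have "\<bar>?S \<Delta>\<bar> \<le> (\<Sum>k\<in>F - {?o}. cos_bound s f k)"
      unfolding cos_bound_def
      by (intro order_trans[OF sum_abs] sum_mono) (simp only: abs_mult, intro mult_left_mono abs_lattice_basis_le abs_ge_zero)
    also have "\<dots> \<le> ?A" using F bnn by (intro finite_sum_le_infsum cos_bound_summable[OF f]) auto
    finally show ?thesis .
  qed
  have approx: "\<bar>?g \<Delta> - ?S \<Delta>\<bar> \<le> \<epsilon>" for \<Delta>
  proof -
    let ?y = "\<lambda>n j. real n * real (z j) / real N + \<Delta> j"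
    let ?d = "\<lambda>n. f (tent_vec s (\<lambda>j\<in>{1..s}. frac (?y n j))) - (\<Sum>k\<in>F. cos_coefficient s f k * periodic_basis s k (?y n))"
    \<comment> \<open>The zero frequency contributes exactly the integral, which cancels in the
      error.\<close>
    have "(\<Sum>k\<in>F. cos_coefficient s f k * lattice_basis s N z k \<Delta>) = cube_integral s f + ?S \<Delta>"
      unfolding sum.remove[OF F(1,3)] zero_freq(2) zero_freq(3)[OF N] by simp
    moreover have "(\<Sum>k\<in>F. cos_coefficient s f k * lattice_basis s N z k \<Delta>) =
        (\<Sum>n<N. \<Sum>k\<in>F. cos_coefficient s f k * periodic_basis s k (?y n)) / real N"
      unfolding lattice_basis_def times_divide_eq_right sum_divide_distrib[symmetric] sum_distrib_left
      by (subst sum.swap) (rule refl)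
    ultimately have eq: "?g \<Delta> - ?S \<Delta> = (\<Sum>n<N. ?d n) / real N"
      unfolding qmc_shifted_lattice o_def sum_subtractf diff_divide_distrib by simp
    have "\<bar>\<Sum>n<N. ?d n\<bar> \<le> (\<Sum>n<N. \<epsilon>)"
      by (intro order_trans[OF sum_abs] sum_mono cos_space_tail[OF f F(1,2) tail])
    then have "\<bar>\<Sum>n<N. ?d n\<bar> \<le> \<epsilon> * real N" by (simp add: mult.commute)
    then show ?thesis unfolding eq abs_divide using N by (simp only: divide_le_eq abs_of_nat of_nat_0_less_iff if_True)
  qed
  have sq: "\<bar>?g \<Delta>\<bar>\<^sup>2 \<le> (?S \<Delta>)\<^sup>2 + ?\<eta>" for \<Delta>
  proof -
    have "\<bar>?g \<Delta>\<bar> \<le> \<bar>?S \<Delta>\<bar> + \<epsilon>" using approx[of \<Delta>] by linarith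
    then have "\<bar>?g \<Delta>\<bar>\<^sup>2 \<le> (\<bar>?S \<Delta>\<bar> + \<epsilon>)\<^sup>2" by (intro power_mono) auto
    also have "\<dots> = (?S \<Delta>)\<^sup>2 + 2 * \<bar>?S \<Delta>\<bar> * \<epsilon> + \<epsilon>\<^sup>2" by (simp add: power2_sum)
    also have "2 * \<bar>?S \<Delta>\<bar> * \<epsilon> \<le> 2 * ?A * \<epsilon>" using S[of \<Delta>] \<epsilon> by (intro mult_right_mono mult_left_mono) auto
    finally show ?thesis by (simp only: add.assoc)
  qed
  have F': "finite (F - {?o})" "F - {?o} \<subseteq> cos_freqs s" using F by auto
  note Sq = lattice_basis_sum_square[OF N F', of "cos_coefficient s f" z]
  \<comment> \<open>The cube has measure 1 by the orthogonality relation for the constant basis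
    function.\<close>
  have one: "set_integrable (lborel_dim s) (half_open_cube s) (\<lambda>\<Delta>. 1 :: real)"
    "(LINT \<Delta>:half_open_cube s|lborel_dim s. 1 :: real) = 1"
    using periodic_basis_orthogonal[OF zero_freq(1) zero_freq(1), of s "\<lambda>_. 0" "\<lambda>_. 0"] unfolding zero_freq(4)
    by simp_all
  have \<eta>: "set_integrable (lborel_dim s) (half_open_cube s) (\<lambda>\<Delta>. ?\<eta>)"
    "(LINT \<Delta>:half_open_cube s|lborel_dim s. ?\<eta>) = ?\<eta>"
    using set_integrable_mult_right[OF one(1), of ?\<eta>] set_integral_mult_right[of "lborel_dim s" "half_open_cube s" ?\<eta> "\<lambda>_. 1"] one(2)
    by simp_all
  have rhs: "(LINT \<Delta>:half_open_cube s|lborel_dim s. (?S \<Delta>)\<^sup>2 + ?\<eta>) = ?V + ?\<eta>"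
    by (simp only: set_integral_add(2)[OF Sq(1) \<eta>(1)] Sq(2) \<eta>(2))
  show ?thesis
  proof (cases "set_integrable (lborel_dim s) (half_open_cube s) (\<lambda>\<Delta>. \<bar>?g \<Delta>\<bar>\<^sup>2)")
    case True
    have "?L \<le> (LINT \<Delta>:half_open_cube s|lborel_dim s. (?S \<Delta>)\<^sup>2 + ?\<eta>)"
      by (intro set_integral_mono True set_integral_add(1) Sq(1) \<eta>(1) sq)
    then show ?thesis unfolding rhs .
  next
    case False
    \<comment> \<open>junk value of the Bochner integral\<close>
    then have "?L = 0" unfolding set_integrable_def set_lebesgue_integral_def by (rule not_integrable_integral_eq)
    moreover have "0 \<le> ?V"
      by (intro sum_nonneg mult_nonneg_nonneg) (auto simp: signed_dual_fraction_def intro!: divide_nonneg_nonneg sum_nonneg)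
    moreover have "0 \<le> ?\<eta>" using A0 \<epsilon> by simp
    ultimately show ?thesis by simp
  qed
qed

section \<open>Averaging over primes and vectors, and conclusion\<close>

definition cbc_average ::
  "nat \<Rightarrow> real \<Rightarrow> (nat \<Rightarrow> real) \<Rightarrow> nat \<Rightarrow> real \<Rightarrow> (nat \<Rightarrow> (nat \<Rightarrow> nat) \<Rightarrow> real) \<Rightarrow> real" where
  "cbc_average s \<alpha> \<gamma> M \<tau> h = 1 / real (card (prime_pool M)) * (\<Sum>N\<in>prime_pool M.
     1 / real (card (cbc_vectors s \<alpha> \<gamma> \<tau> N)) * (\<Sum>z\<in>cbc_vectors s \<alpha> \<gamma> \<tau> N. h N z))"

lemma cbc_average_mono:
  assumes "\<And>N z. N \<in> prime_pool M \<Longrightarrow> h N z \<le> h' N z"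
  shows "cbc_average s \<alpha> \<gamma> M \<tau> h \<le> cbc_average s \<alpha> \<gamma> M \<tau> h'"
  unfolding cbc_average_def using assms by (intro mult_left_mono sum_mono) auto

lemma cbc_average_add:
  "cbc_average s \<alpha> \<gamma> M \<tau> (\<lambda>N z. h N z + h' N z) = cbc_average s \<alpha> \<gamma> M \<tau> h + cbc_average s \<alpha> \<gamma> M \<tau> h'"
  unfolding cbc_average_def by (simp only: sum.distrib distrib_left)

lemma cbc_average_sum:
  "cbc_average s \<alpha> \<gamma> M \<tau> (\<lambda>N z. \<Sum>k\<in>F. a k * h k N z) = (\<Sum>k\<in>F. a k * cbc_average s \<alpha> \<gamma> M \<tau> (h k))"
proof (induction F rule: infinite_finite_induct)
  case (insert k F)
  have "cbc_average s \<alpha> \<gamma> M \<tau> (\<lambda>N z. a k * h k N z) = a k * cbc_average s \<alpha> \<gamma> M \<tau> (h k)"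
    unfolding cbc_average_def sum_distrib_left by (intro sum.cong refl) (simp only: mult_ac)
  then show ?case using insert by (simp add: cbc_average_add)
qed (simp_all add: cbc_average_def)

text \<open>Only an inequality, since an average over an empty set is 0 by the convention x / 0 =
  0.\<close>

lemma cbc_average_const_le:
  assumes "0 \<le> c"
  shows "cbc_average s \<alpha> \<gamma> M \<tau> (\<lambda>N z. c) \<le> c"
proof -
  have inner: "1 / real (card A) * (\<Sum>x\<in>A. c) \<le> c" for A :: "(nat \<Rightarrow> nat) set"
  proof (cases "card A = 0")
    case False
    then show ?thesis by simp
  qed (use assms in simp)
  show ?thesis
    unfolding cbc_average_def
  proof (cases "card (prime_pool M) = 0")
    case False
    have "(\<Sum>N\<in>prime_pool M. 1 / real (card (cbc_vectors s \<alpha> \<gamma> \<tau> N)) * (\<Sum>z\<in>cbc_vectors s \<alpha> \<gamma> \<tau> N. c)) \<le> (\<Sum>N\<in>prime_pool M. c)"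
      by (intro sum_mono inner)
    then show "1 / real (card (prime_pool M)) * (\<Sum>N\<in>prime_pool M. 1 / real (card (cbc_vectors s \<alpha> \<gamma> \<tau> N)) * (\<Sum>z\<in>cbc_vectors s \<alpha> \<gamma> \<tau> N. c)) \<le> c"
      using False by (simp add: divide_le_eq mult.commute)
  qed (use assms in simp)
qed

lemma dual_prob_eq_cbc_average:
  "dual_prob s \<alpha> \<gamma> M \<tau> h =
    cbc_average s \<alpha> \<gamma> M \<tau> (\<lambda>N z. if int N dvd (\<Sum>j\<in>{1..s}. h j * int (z j)) then 1 else 0)"
  unfolding dual_prob_def cbc_average_def
  by (simp only: sum.inter_filter[symmetric] finite_cbc_vectors) simp

lemma cbc_average_signed_dual_fraction:
  "cbc_average s \<alpha> \<gamma> M \<tau> (\<lambda>N z. signed_dual_fraction s N z k) =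
    (\<Sum>e\<in>{1..s} \<rightarrow>\<^sub>E {-1, 1}. dual_prob s \<alpha> \<gamma> M \<tau> (\<lambda>j\<in>{1..s}. e j * int (k j))) / 2 ^ s"
proof -
  have eq: "(\<Sum>j\<in>{1..s}. e j * int (k j) * int (z j)) = (\<Sum>j\<in>{1..s}. (\<lambda>j\<in>{1..s}. e j * int (k j)) j * int (z j))" for e and z :: "nat \<Rightarrow> nat"
    by (intro sum.cong refl) simp
  have "(\<lambda>N z. signed_dual_fraction s N z k) = (\<lambda>N z. \<Sum>e\<in>{1..s} \<rightarrow>\<^sub>E {-1, 1}. 1 / 2 ^ s *
      (if int N dvd (\<Sum>j\<in>{1..s}. (\<lambda>j\<in>{1..s}. e j * int (k j)) j * int (z j)) then 1 else 0))"
    unfolding signed_dual_fraction_def eq by (simp only: sum_divide_distrib times_divide_eq_left mult_1_left)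
  then show ?thesis
    unfolding dual_prob_eq_cbc_average sum_divide_distrib by (simp only: cbc_average_sum) simp
qed

text \<open>Only moduli enter \<open>r_weight\<close>, so all sign patterns of a frequency share one
  bound.\<close>

lemma r_weight_sign:
  assumes "e \<in> {1..s} \<rightarrow>\<^sub>E {-1, 1::int}"
  shows "r_weight \<alpha> \<gamma> s (\<lambda>j\<in>{1..s}. e j * int (k j)) = r_weight \<alpha> \<gamma> s (\<lambda>j. int (k j))"
proof -
  let ?h = "\<lambda>j\<in>{1..s}. e j * int (k j)"
  have "e j \<in> {-1, 1}" if "j \<in> {1..s}" for j using assms that by (rule PiE_mem)
  then have nz: "?h j \<noteq> 0 \<longleftrightarrow> int (k j) \<noteq> 0"
    and ab: "\<bar>real_of_int (?h j)\<bar> = \<bar>real_of_int (int (k j))\<bar>" if "j \<in> {1..s}" for j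
    using that by (force simp: abs_mult)+
  show ?thesis
    unfolding r_weight_def
  proof (rule prod.cong)
    show "{j \<in> {1..s}. ?h j \<noteq> 0} = {j \<in> {1..s}. int (k j) \<noteq> 0}"
      using nz by blast
  qed (simp only: ab mem_Collect_eq)
qed

text \<open>The probability bound, averaged over sign patterns, makes the term of each nonzero
  frequency at most \<open>B\<close> times its term in the squared norm, and these add up to at most
  1. The truncation error is absorbed by an arbitrary \<eta>.\<close>

lemma tent_mean_square_error_le:
  assumes f: "f \<in> cos_space s \<alpha> \<gamma>" "cos_norm s \<alpha> \<gamma> f \<le> 1" and B: "0 \<le> B"
    and prob: "\<And>h i. h \<in> {1..s} \<rightarrow>\<^sub>E UNIV \<Longrightarrow> (\<And>j. j \<in> {1..s} \<Longrightarrow> h j \<noteq> 0 \<Longrightarrow> \<gamma> j \<noteq> 0) \<Longrightarrow> i \<in> {1..s} \<Longrightarrow> h i \<noteq> 0 \<Longrightarrow>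
      dual_prob s \<alpha> \<gamma> M \<tau> h \<le> B * (r_weight \<alpha> \<gamma> s h)\<^sup>2"
  shows "tent_mean_square_error s \<alpha> \<gamma> M \<tau> f \<le> B"
proof (rule field_le_epsilon)
  fix \<eta> :: real assume \<eta>: "0 < \<eta>"
  let ?A = "infsum (cos_bound s f) (cos_freqs s)" and ?o = "\<lambda>j\<in>{1..s}. 0 :: nat"
  let ?a = "cos_coefficient s f"
  have A0: "0 \<le> ?A" using cos_basis_zero_nonneg by (intro infsum_nonneg) (auto simp: cos_bound_def)
  obtain \<epsilon> where \<epsilon>: "0 < \<epsilon>" "2 * ?A * \<epsilon> + \<epsilon>\<^sup>2 \<le> \<eta>"
  proof -
    \<comment> \<open>The minimum with 1 ensures \<epsilon>^2 \<le> \<epsilon>.\<close>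
    define \<epsilon> where "\<epsilon> = min 1 (\<eta> / (2 * ?A + 1))"
    have e: "0 < \<epsilon>" "\<epsilon> \<le> 1" "\<epsilon> \<le> \<eta> / (2 * ?A + 1)" using \<eta> A0 by (auto simp: \<epsilon>_def)
    have "2 * ?A * \<epsilon> + \<epsilon>\<^sup>2 \<le> 2 * ?A * \<epsilon> + 1 * \<epsilon>"
      unfolding power2_eq_square using e by (intro add_left_mono mult_right_mono) auto
    also have "\<dots> = \<epsilon> * (2 * ?A + 1)" by (simp add: algebra_simps)
    also have "\<dots> \<le> \<eta>" using e(3) A0 by (simp add: le_divide_eq)
    finally show thesis using e(1) by (intro that)
  qed
  obtain F where F: "finite F" "F \<subseteq> cos_freqs s" "?o \<in> F" and tail: "?A - sum (cos_bound s f) F \<le> \<epsilon>"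
    using exists_small_tail[OF f(1) \<epsilon>(1)] .
  have "tent_mean_square_error s \<alpha> \<gamma> M \<tau> f = cbc_average s \<alpha> \<gamma> M \<tau> (\<lambda>N z.
      LINT \<Delta>:half_open_cube s|lborel_dim s. \<bar>qmc (f \<circ> tent_vec s) (shifted_lattice s N z \<Delta>) - cube_integral s f\<bar>\<^sup>2)"
    unfolding tent_mean_square_error_def cbc_average_def ..
  also have "\<dots> \<le> cbc_average s \<alpha> \<gamma> M \<tau> (\<lambda>N z.
      (\<Sum>k\<in>F - {?o}. (?a k)\<^sup>2 * signed_dual_fraction s N z k) + (2 * ?A * \<epsilon> + \<epsilon>\<^sup>2))"
    by (intro cbc_average_mono shift_mean_square_le[OF f(1) _ F \<epsilon>(1) tail]) (auto simp: prime_pool_def prime_gt_0_nat)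
  also have "\<dots> = (\<Sum>k\<in>F - {?o}. (?a k)\<^sup>2 * cbc_average s \<alpha> \<gamma> M \<tau> (\<lambda>N z. signed_dual_fraction s N z k))
      + cbc_average s \<alpha> \<gamma> M \<tau> (\<lambda>N z. 2 * ?A * \<epsilon> + \<epsilon>\<^sup>2)"
    by (simp only: cbc_average_add cbc_average_sum)
  also have "cbc_average s \<alpha> \<gamma> M \<tau> (\<lambda>N z. 2 * ?A * \<epsilon> + \<epsilon>\<^sup>2) \<le> 2 * ?A * \<epsilon> + \<epsilon>\<^sup>2"
    using A0 \<epsilon> by (intro cbc_average_const_le) auto
  also have "\<dots> \<le> \<eta>" by (rule \<epsilon>(2))
  also have "(\<Sum>k\<in>F - {?o}. (?a k)\<^sup>2 * cbc_average s \<alpha> \<gamma> M \<tau> (\<lambda>N z. signed_dual_fraction s N z k)) \<le>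
      (\<Sum>k\<in>F - {?o}. B * cos_norm_term s \<alpha> \<gamma> f k)"
  proof (intro sum_mono)
    fix k assume k: "k \<in> F - {?o}"
    then have kf: "k \<in> cos_freqs s" using F by auto
    show "(?a k)\<^sup>2 * cbc_average s \<alpha> \<gamma> M \<tau> (\<lambda>N z. signed_dual_fraction s N z k) \<le> B * cos_norm_term s \<alpha> \<gamma> f k"
    proof (cases "?a k = 0")
      case True
      then show ?thesis by (simp add: cos_norm_term_def)
    next
      case False
      \<comment> \<open>Membership in the space makes the weights nonzero on the support of
        \<open>k\<close>, as the probability bound demands; a zero weight would make its right side
        0.\<close>
      have g: "\<gamma> j \<noteq> 0" if "j \<in> {1..s}" "k j \<noteq> 0" for j
        using f(1) False kf that unfolding cos_space_def by blast
      obtain i where i: "i \<in> {1..s}" "k i \<noteq> 0"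
      proof -
        obtain i where "k i \<noteq> ?o i" using k by blast
        then show thesis using kf that[of i]
          by (cases "i \<in> {1..s}") (auto simp: cos_freqs_def PiE_def extensional_def)
      qed
      let ?E = "{1..s} \<rightarrow>\<^sub>E {-1, 1::int}"
      have "(\<Sum>e\<in>?E. dual_prob s \<alpha> \<gamma> M \<tau> (\<lambda>j\<in>{1..s}. e j * int (k j))) \<le>
          (\<Sum>e\<in>?E. B * (r_weight \<alpha> \<gamma> s (\<lambda>j. int (k j)))\<^sup>2)"
      proof (intro sum_mono)
        fix e assume e: "e \<in> ?E"
        then have "e j \<noteq> 0" if "j \<in> {1..s}" for j using that by (auto dest: PiE_mem)
        then have "dual_prob s \<alpha> \<gamma> M \<tau> (\<lambda>j\<in>{1..s}. e j * int (k j)) \<le> B * (r_weight \<alpha> \<gamma> s (\<lambda>j\<in>{1..s}. e j * int (k j)))\<^sup>2"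
          using g i by (intro prob[of _ i]) auto
        then show "dual_prob s \<alpha> \<gamma> M \<tau> (\<lambda>j\<in>{1..s}. e j * int (k j)) \<le> B * (r_weight \<alpha> \<gamma> s (\<lambda>j. int (k j)))\<^sup>2"
          by (simp only: r_weight_sign[OF e])
      qed
      also have "\<dots> = 2 ^ s * (B * (r_weight \<alpha> \<gamma> s (\<lambda>j. int (k j)))\<^sup>2)"
        by (simp add: card_PiE)
      finally have "cbc_average s \<alpha> \<gamma> M \<tau> (\<lambda>N z. signed_dual_fraction s N z k) \<le> B * (r_weight \<alpha> \<gamma> s (\<lambda>j. int (k j)))\<^sup>2"
        unfolding cbc_average_signed_dual_fraction by (simp add: divide_le_eq mult.commute)
      then have "(?a k)\<^sup>2 * cbc_average s \<alpha> \<gamma> M \<tau> (\<lambda>N z. signed_dual_fraction s N z k) \<le>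
        (?a k)\<^sup>2 * (B * (r_weight \<alpha> \<gamma> s (\<lambda>j. int (k j)))\<^sup>2)" by (intro mult_left_mono) auto
      then show ?thesis by (simp add: cos_norm_term_def mult_ac)
    qed
  qed
  also have "\<dots> = B * (\<Sum>k\<in>F - {?o}. cos_norm_term s \<alpha> \<gamma> f k)" by (simp only: sum_distrib_left)
  also have "\<dots> \<le> B * 1"
  proof (intro mult_left_mono B)
    have "(\<Sum>k\<in>F - {?o}. cos_norm_term s \<alpha> \<gamma> f k) \<le> infsum (cos_norm_term s \<alpha> \<gamma> f) (cos_freqs s)"
    proof (rule finite_sum_le_infsum)
      show "cos_norm_term s \<alpha> \<gamma> f summable_on cos_freqs s" using f(1) by (simp add: cos_space_def)
    qed (use F in \<open>auto simp: cos_norm_term_def\<close>)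
    also have "\<dots> \<le> 1" using f(2) by (simp add: cos_norm_def real_sqrt_le_1_iff)
    finally show "(\<Sum>k\<in>F - {?o}. cos_norm_term s \<alpha> \<gamma> f k) \<le> 1" .
  qed
  finally show "tent_mean_square_error s \<alpha> \<gamma> M \<tau> f \<le> B + \<eta>" by simp
qed

theorem mainTheorem5:
  "\<exists>c'::real. c' > 0 \<and>
     (\<forall>(M::nat) (s::nat) (\<alpha>::real) (\<gamma>::nat \<Rightarrow> real) (\<tau>::real) (lam::real) (\<delta>::real).
        2 \<le> M \<longrightarrow> 1 \<le> s \<longrightarrow> 1 / 2 < \<alpha> \<longrightarrow> (\<forall>j\<ge>1. 0 \<le> \<gamma> j \<and> \<gamma> j \<le> 1) \<longrightarrow>
        0 < \<tau> \<longrightarrow> \<tau> < 1 \<longrightarrow> 1 / 2 \<le> lam \<longrightarrow> lam < \<alpha> \<longrightarrow> 0 < \<delta> \<longrightarrow> \<delta> < 1 \<longrightarrow>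
        tent_rms_error s \<alpha> \<gamma> M \<tau> \<le>
          ennreal (sqrt (c' / (\<delta> * \<tau> * real M)) *
            (2 / ((1 - \<tau>) * real M) *
              (\<Sum>u\<in>Pow {1..s} - {{}}.
                 (\<Prod>j\<in>u. \<gamma> j) powr (1 / lam) * (2 * real_zeta (\<alpha> / lam)) ^ card u))
            powr (lam * (1 - \<delta> / (2 * \<alpha>)))))"
proof -
  obtain c where c: "0 < c" and pool: "\<And>M. M \<ge> 2 \<Longrightarrow> prime_pool M \<noteq> {} \<Longrightarrow> c * real M \<le> real (card (prime_pool M)) * ln (real M)"
    using prime_pool_card_ge by blast
  show ?thesis
  \<comment> \<open>The first 2 comes from N - 1 \<ge> M / 2, the second from M \<le> N^2 in the
    divisor count, and \<open>c\<close> from the size of the pool.\<close>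
  proof (intro exI[of _ "2 + 2 / c"] conjI allI impI)
    show "0 < 2 + 2 / c" using c by (simp add: add_pos_pos)
    fix M s :: nat and \<alpha> :: real and \<gamma> :: "nat \<Rightarrow> real" and \<tau> lam \<delta> :: real
    assume M: "2 \<le> M" and s: "1 \<le> s" and alpha: "1 / 2 < \<alpha>" and \<gamma>: "\<forall>j\<ge>1. 0 \<le> \<gamma> j \<and> \<gamma> j \<le> 1"
      and tau: "0 < \<tau>" "\<tau> < 1" and lam: "1 / 2 \<le> lam" "lam < \<alpha>" and \<delta>: "0 < \<delta>" "\<delta> < 1"
    define Q where "Q = 2 / ((1 - \<tau>) * real M) * (\<Sum>u\<in>Pow {1..s} - {{}}.
                 (\<Prod>j\<in>u. \<gamma> j) powr (1 / lam) * (2 * real_zeta (\<alpha> / lam)) ^ card u)"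
    define e where "e = lam * (1 - \<delta> / (2 * \<alpha>))"
    define K where "K = (2 + 2 / c) / (\<delta> * \<tau> * real M)"
    have K0: "0 \<le> K" using c \<delta> tau by (simp add: K_def)
    have mse: "tent_mean_square_error s \<alpha> \<gamma> M \<tau> f \<le> K * Q powr (2 * e)"
      if f: "f \<in> cos_space s \<alpha> \<gamma>" "cos_norm s \<alpha> \<gamma> f \<le> 1" for f
    proof (cases "prime_pool M = {}")
      \<comment> \<open>With an empty pool the sum over the primes is empty and the error is
        0.\<close>
      case True
      then show ?thesis using K0 by (simp add: tent_mean_square_error_def)
    next
      case False
      show ?thesis
      proof (rule tent_mean_square_error_le[OF f])
        fix h :: "nat \<Rightarrow> int" and i
        assume h: "h \<in> {1..s} \<rightarrow>\<^sub>E UNIV" "\<And>j. j \<in> {1..s} \<Longrightarrow> h j \<noteq> 0 \<Longrightarrow> \<gamma> j \<noteq> 0" "i \<in> {1..s}" "h i \<noteq> 0"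
        have "dual_prob s \<alpha> \<gamma> M \<tau> h \<le> (2 + 2 / c) / (\<delta> * \<tau> * real M) * Q powr (2 * lam * (1 - \<delta> / (2 * \<alpha>))) * (r_weight \<alpha> \<gamma> s h)\<^sup>2"
          using \<gamma> by (intro dual_prob_le_r_weight[OF tau s M c pool[OF M False] alpha lam \<delta> _ h Q_def]) auto
        then show "dual_prob s \<alpha> \<gamma> M \<tau> h \<le> K * Q powr (2 * e) * (r_weight \<alpha> \<gamma> s h)\<^sup>2"
          by (simp only: K_def e_def mult.assoc)
      qed (use K0 in simp)
    qed
    have "ennreal (sqrt (tent_mean_square_error s \<alpha> \<gamma> M \<tau> f)) \<le> ennreal (sqrt K * Q powr e)"
      if f: "f \<in> cos_space s \<alpha> \<gamma>" "cos_norm s \<alpha> \<gamma> f \<le> 1" for f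
    proof (rule ennreal_leI)
      have "Q powr (2 * e) = (Q powr e)\<^sup>2" by (simp add: power2_eq_square powr_add[symmetric])
      then have "sqrt (K * Q powr (2 * e)) = sqrt K * Q powr e" by (simp add: real_sqrt_mult)
      then show "sqrt (tent_mean_square_error s \<alpha> \<gamma> M \<tau> f) \<le> sqrt K * Q powr e"
        using mse[OF f] by (metis real_sqrt_le_iff)
    qed
    then show "tent_rms_error s \<alpha> \<gamma> M \<tau> \<le>
          ennreal (sqrt ((2 + 2 / c) / (\<delta> * \<tau> * real M)) *
            (2 / ((1 - \<tau>) * real M) *
              (\<Sum>u\<in>Pow {1..s} - {{}}.
                 (\<Prod>j\<in>u. \<gamma> j) powr (1 / lam) * (2 * real_zeta (\<alpha> / lam)) ^ card u))
            powr (lam * (1 - \<delta> / (2 * \<alpha>))))"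
      unfolding tent_rms_error_def K_def Q_def e_def by (intro SUP_least) simp
  qed
qed

end
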